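(* Let $(G,\pi)$ be a Poisson--Lie group, let $H$ be a closed subgroup of $G$ and let $\sigma\in G$ be such that the conjugate subgroup $H_\sigma:=\operatorname{Ad}_\sigma H=\sigma H\sigma^{-1}$ is coisotropic in $(G,\pi)$. Let $\pi_\sigma$ be the affine Poisson structure on $G$ given by $\pi_\sigma(g):=R_\sigma\pi(g\sigma^{-1})$. Let $p:G\to G/H$ and $p_\sigma:G\to G/H_\sigma$ be the natural projections. Then the Poisson manifolds $(G/H,p_*\pi_\sigma)$ and $(G/H_\sigma,(p_\sigma)_*\pi)$ are Poisson diffeomorphic.
   Context: $R_\sigma$ denotes right translation by $\sigma$ on $G$ and the induced map on bivectors. A closed subgroup $K$ (with Lie algebra $\mathfrak k$) of a Poisson--Lie group $(G,\pi)$ with Lie algebra $\mathfrak g$ is coisotropic if $\pi(k)\in L_k(\mathfrak k\wedge\mathfrak g)$ for all $k\in K$, where $L_k$ is left translation and $\mathfrak k\wedge\mathfrak g\subseteq\wedge^2\mathfrak g$ is the span of $x\wedge y$, $x\in\mathfrak k$, $y\in\mathfrak g$; equivalently (for Poisson--Lie $\pi$) $\pi(gk)-R_k\pi(g)\in L_{gk}(\mathfrak k\wedge\mathfrak g)$ for all $g\in G$, $k\in K$. Under the coisotropy assumption, $\pi$ projects to a well-defined Poisson structure $(p_\sigma)_*\pi$ on $G/H_\sigma$, and $\pi_\sigma$ projects to a well-defined Poisson structure $p_*\pi_\sigma$ on $G/H$. A 2-tensor $\rho$ on $G$ is affine if $\rho(gh)=L_g\rho(h)+R_h\rho(g)-L_gR_h\rho(e)$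 for all $g,h\in G$. *)

theory Defs
  imports "HOL-Analysis.Analysis" "HOL-Algebra.Left_Coset"
begin

section \<open>Smooth maps between subsets of Euclidean spaces\<close>

primrec Ck_on :: "nat \<Rightarrow> 'a::euclidean_space set \<Rightarrow> ('a \<Rightarrow> 'b::euclidean_space) \<Rightarrow> bool" where
  "Ck_on 0 S f \<longleftrightarrow> continuous_on S f"
| "Ck_on (Suc k) S f \<longleftrightarrow>
     (\<forall>x\<in>S. f differentiable (at x)) \<and> (\<forall>v. Ck_on k S (\<lambda>x. frechet_derivative f (at x) v))"

text \<open>On an arbitrary set, smoothness means local extendability to a smooth function on an open
  subset of the ambient space.  For a relatively open subset of a linear subspace
  this is the usual notion of a smooth function on that subspace.\<close>

definition smooth_on :: "'a::euclidean_space set \<Rightarrow> ('a \<Rightarrow> 'b::euclidean_space) \<Rightarrow> bool" where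
  "smooth_on S f \<longleftrightarrow>
     (\<forall>x\<in>S. \<exists>W g. open W \<and> x \<in> W \<and> (\<forall>k. Ck_on k W g) \<and> (\<forall>y\<in>S \<inter> W. g y = f y))"

section \<open>Smooth manifolds\<close>

text \<open>A chart maps an open set homeomorphically onto an open subset of a linear subspace
  (its model space) of the type \<open>'e\<close>.  Since \<open>'e\<close> is an arbitrary Euclidean space, all finite
  dimensions occur, including dimension 0, and manifolds of different dimensions
  (such as \<open>G\<close> and \<open>G/H\<close>) can use the same \<open>'e\<close>.\<close>

record ('a, 'e) chart =
  chart_dom :: "'a set"
  chart_map :: "'a \<Rightarrow> 'e"
  chart_space :: "'e set"

record ('a, 'e) mfd =
  mfd_top :: "'a topology"
  mfd_atlas :: "('a, 'e) chart set"

abbreviation points :: "('a, 'e) mfd \<Rightarrow> 'a set" where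
  "points M \<equiv> topspace (mfd_top M)"

definition is_chart :: "'a topology \<Rightarrow> ('a, 'e::euclidean_space) chart \<Rightarrow> bool" where
  "is_chart X c \<longleftrightarrow>
     openin X (chart_dom c) \<and> subspace (chart_space c) \<and>
     openin (top_of_set (chart_space c)) (chart_map c ` chart_dom c) \<and>
     homeomorphic_map (subtopology X (chart_dom c))
       (top_of_set (chart_map c ` chart_dom c)) (chart_map c)"

text \<open>The expression of a map \<open>f\<close> in the charts \<open>c\<close> (source) and \<open>d\<close> (target), and the set on which
  it is defined.\<close>

definition local_dom :: "('a, 'e) chart \<Rightarrow> ('b, 'f) chart \<Rightarrow> ('a \<Rightarrow> 'b) \<Rightarrow> 'e set" where
  "local_dom c d f = chart_map c ` {x \<in> chart_dom c. f x \<in> chart_dom d}"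

definition local_rep :: "('a, 'e) chart \<Rightarrow> ('b, 'f) chart \<Rightarrow> ('a \<Rightarrow> 'b) \<Rightarrow> 'e \<Rightarrow> 'f" where
  "local_rep c d f = chart_map d \<circ> f \<circ> inv_into (chart_dom c) (chart_map c)"

definition smooth_in_charts ::
    "('a, 'e::euclidean_space) chart \<Rightarrow> ('b, 'f::euclidean_space) chart \<Rightarrow> ('a \<Rightarrow> 'b) \<Rightarrow> bool" where
  "smooth_in_charts c d f \<longleftrightarrow> smooth_on (local_dom c d f) (local_rep c d f)"

definition submersive_in_charts ::
    "('a, 'e::euclidean_space) chart \<Rightarrow> ('b, 'f::euclidean_space) chart \<Rightarrow> ('a \<Rightarrow> 'b) \<Rightarrow> bool" where
  "submersive_in_charts c d f \<longleftrightarrow>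
     smooth_in_charts c d f \<and>
     (\<forall>u\<in>local_dom c d f. \<exists>D.
        (local_rep c d f has_derivative D) (at u within local_dom c d f) \<and>
        D ` chart_space c = chart_space d)"

definition smooth_manifold :: "('a, 'e::euclidean_space) mfd \<Rightarrow> bool" where
  "smooth_manifold M \<longleftrightarrow>
     Hausdorff_space (mfd_top M) \<and> second_countable (mfd_top M) \<and>
     (\<forall>c\<in>mfd_atlas M. is_chart (mfd_top M) c) \<and>
     (\<Union>c\<in>mfd_atlas M. chart_dom c) = points M \<and>
     (\<exists>n. \<forall>c\<in>mfd_atlas M. chart_dom c \<noteq> {} \<longrightarrow> dim (chart_space c) = n) \<and>
     (\<forall>c\<in>mfd_atlas M. \<forall>d\<in>mfd_atlas M. smooth_in_charts c d (\<lambda>x. x))"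

definition smooth_map ::
    "('a, 'e::euclidean_space) mfd \<Rightarrow> ('b, 'f::euclidean_space) mfd \<Rightarrow> ('a \<Rightarrow> 'b) \<Rightarrow> bool" where
  "smooth_map M N f \<longleftrightarrow>
     continuous_map (mfd_top M) (mfd_top N) f \<and>
     (\<forall>c\<in>mfd_atlas M. \<forall>d\<in>mfd_atlas N. smooth_in_charts c d f)"

definition diffeomorphism ::
    "('a, 'e::euclidean_space) mfd \<Rightarrow> ('b, 'f::euclidean_space) mfd \<Rightarrow> ('a \<Rightarrow> 'b) \<Rightarrow> bool" where
  "diffeomorphism M N f \<longleftrightarrow>
     bij_betw f (points M) (points N) \<and> smooth_map M N f \<and>
     smooth_map N M (inv_into (points M) f)"

definition euclidean_mfd :: "('e::euclidean_space, 'e) mfd" where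
  "euclidean_mfd =
     \<lparr>mfd_top = euclidean,
      mfd_atlas = {\<lparr>chart_dom = UNIV, chart_map = (\<lambda>x. x), chart_space = UNIV\<rparr>}\<rparr>"

definition product_mfd :: "('a, 'e) mfd \<Rightarrow> ('b, 'f) mfd \<Rightarrow> ('a \<times> 'b, 'e \<times> 'f) mfd" where
  "product_mfd M N =
     \<lparr>mfd_top = prod_topology (mfd_top M) (mfd_top N),
      mfd_atlas = {\<lparr>chart_dom = chart_dom c \<times> chart_dom d,
                    chart_map = map_prod (chart_map c) (chart_map d),
                    chart_space = chart_space c \<times> chart_space d\<rparr> | c d.
                   c \<in> mfd_atlas M \<and> d \<in> mfd_atlas N}\<rparr>"

section \<open>Tangent vectors and bivectors\<close>

definition smooth_funs :: "('a, 'e::euclidean_space) mfd \<Rightarrow> ('a \<Rightarrow> real) set" where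
  "smooth_funs M = {f. smooth_map M (euclidean_mfd :: (real, real) mfd) f}"

text \<open>Tangent vectors are derivations of the algebra of smooth functions, and bivectors are
  skew-symmetric biderivations: \<open>B f g\<close> is the value of the bivector on the covectors
  \<open>df\<close> and \<open>dg\<close>.  To make equality of these objects meaningful, both are set to 0 on functions
  that are not smooth.\<close>

definition tangent_space :: "('a, 'e::euclidean_space) mfd \<Rightarrow> 'a \<Rightarrow> (('a \<Rightarrow> real) \<Rightarrow> real) set" where
  "tangent_space M x =
     {D. (\<forall>f\<in>smooth_funs M. \<forall>g\<in>smooth_funs M. \<forall>a b.
            D (\<lambda>y. a * f y + b * g y) = a * D f + b * D g) \<and>
         (\<forall>f\<in>smooth_funs M. \<forall>g\<in>smooth_funs M.
            D (\<lambda>y. f y * g y) = f x * D g + g x * D f) \<and>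
         (\<forall>f. f \<notin> smooth_funs M \<longrightarrow> D f = 0)}"

type_synonym 'a tensor2 = "('a \<Rightarrow> real) \<Rightarrow> ('a \<Rightarrow> real) \<Rightarrow> real"

definition bivectors :: "('a, 'e::euclidean_space) mfd \<Rightarrow> 'a \<Rightarrow> 'a tensor2 set" where
  "bivectors M x =
     {B. (\<forall>f g. B f g = - B g f) \<and> (\<forall>g. (\<lambda>f. B f g) \<in> tangent_space M x)}"

definition wedge :: "(('a \<Rightarrow> real) \<Rightarrow> real) \<Rightarrow> (('a \<Rightarrow> real) \<Rightarrow> real) \<Rightarrow> 'a tensor2" where
  "wedge X Y = (\<lambda>f g. X f * Y g - X g * Y f)"

definition wedge_span ::
    "(('a \<Rightarrow> real) \<Rightarrow> real) set \<Rightarrow> (('a \<Rightarrow> real) \<Rightarrow> real) set \<Rightarrow> 'a tensor2 set" where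
  "wedge_span A B =
     {\<lambda>f g. \<Sum>i<n. a i * wedge (X i) (Y i) f g | (n::nat) (a :: nat \<Rightarrow> real) X Y.
        \<forall>i<n. X i \<in> A \<and> Y i \<in> B}"

text \<open>The map induced on 2-tensors by the differential of \<open>F\<close>.  The base point is implicit:
  a biderivation at \<open>x\<close> is sent to one at \<open>F x\<close>.\<close>

definition pushforward ::
    "('a, 'e::euclidean_space) mfd \<Rightarrow> ('b, 'f::euclidean_space) mfd \<Rightarrow> ('a \<Rightarrow> 'b)
       \<Rightarrow> 'a tensor2 \<Rightarrow> 'b tensor2" where
  "pushforward M N F B =
     (\<lambda>f g. if f \<in> smooth_funs N \<and> g \<in> smooth_funs N then B (f \<circ> F) (g \<circ> F) else 0)"

text \<open>A 2-tensor field projects along \<open>F\<close> if its image at a point \<open>F x\<close> does not depend on the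
  choice of \<open>x\<close>; the projection is then determined on the image of \<open>F\<close>.\<close>

definition projectable ::
    "('a, 'e::euclidean_space) mfd \<Rightarrow> ('b, 'f::euclidean_space) mfd \<Rightarrow> ('a \<Rightarrow> 'b)
       \<Rightarrow> ('a \<Rightarrow> 'a tensor2) \<Rightarrow> bool" where
  "projectable M N F \<pi> \<longleftrightarrow>
     (\<forall>x\<in>points M. \<forall>x'\<in>points M. F x = F x' \<longrightarrow>
        pushforward M N F (\<pi> x) = pushforward M N F (\<pi> x'))"

definition project_field ::
    "('a, 'e::euclidean_space) mfd \<Rightarrow> ('b, 'f::euclidean_space) mfd \<Rightarrow> ('a \<Rightarrow> 'b)
       \<Rightarrow> ('a \<Rightarrow> 'a tensor2) \<Rightarrow> 'b \<Rightarrow> 'b tensor2" where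
  "project_field M N F \<pi> y =
     (THE B. \<forall>x\<in>points M. F x = y \<longrightarrow> pushforward M N F (\<pi> x) = B)"

section \<open>Poisson structures\<close>

definition poisson_structure ::
    "('a, 'e::euclidean_space) mfd \<Rightarrow> ('a \<Rightarrow> 'a tensor2) \<Rightarrow> bool" where
  "poisson_structure M \<pi> \<longleftrightarrow>
     (\<forall>x\<in>points M. \<pi> x \<in> bivectors M x) \<and>
     (\<forall>f\<in>smooth_funs M. \<forall>g\<in>smooth_funs M. (\<lambda>x. \<pi> x f g) \<in> smooth_funs M) \<and>
     (\<forall>f\<in>smooth_funs M. \<forall>g\<in>smooth_funs M. \<forall>h\<in>smooth_funs M. \<forall>x\<in>points M.
        \<pi> x f (\<lambda>y. \<pi> y g h) + \<pi> x g (\<lambda>y. \<pi> y h f) + \<pi> x h (\<lambda>y. \<pi> y f g) = 0)"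

definition poisson_diffeomorphic ::
    "('a, 'e::euclidean_space) mfd \<Rightarrow> ('a \<Rightarrow> 'a tensor2) \<Rightarrow>
     ('b, 'f::euclidean_space) mfd \<Rightarrow> ('b \<Rightarrow> 'b tensor2) \<Rightarrow> bool" where
  "poisson_diffeomorphic M \<pi> N \<rho> \<longleftrightarrow>
     (\<exists>\<Phi>. diffeomorphism M N \<Phi> \<and> (\<forall>x\<in>points M. pushforward M N \<Phi> (\<pi> x) = \<rho> (\<Phi> x)))"

section \<open>Poisson--Lie groups\<close>

definition lie_group :: "'g monoid \<Rightarrow> ('g, 'e::euclidean_space) mfd \<Rightarrow> bool" where
  "lie_group G M \<longleftrightarrow>
     group G \<and> smooth_manifold M \<and> points M = carrier G \<and>
     smooth_map (product_mfd M M) M (\<lambda>(x, y). x \<otimes>\<^bsub>G\<^esub> y) \<and>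
     smooth_map M M (\<lambda>x. inv\<^bsub>G\<^esub> x)"

definition left_transl ::
    "'g monoid \<Rightarrow> ('g, 'e::euclidean_space) mfd \<Rightarrow> 'g \<Rightarrow> 'g tensor2 \<Rightarrow> 'g tensor2" where
  "left_transl G M a = pushforward M M (\<lambda>x. a \<otimes>\<^bsub>G\<^esub> x)"

definition right_transl ::
    "'g monoid \<Rightarrow> ('g, 'e::euclidean_space) mfd \<Rightarrow> 'g \<Rightarrow> 'g tensor2 \<Rightarrow> 'g tensor2" where
  "right_transl G M a = pushforward M M (\<lambda>x. x \<otimes>\<^bsub>G\<^esub> a)"

definition multiplicative ::
    "'g monoid \<Rightarrow> ('g, 'e::euclidean_space) mfd \<Rightarrow> ('g \<Rightarrow> 'g tensor2) \<Rightarrow> bool" where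
  "multiplicative G M \<pi> \<longleftrightarrow>
     (\<forall>a\<in>carrier G. \<forall>b\<in>carrier G.
        \<pi> (a \<otimes>\<^bsub>G\<^esub> b) =
          (\<lambda>f g. left_transl G M a (\<pi> b) f g + right_transl G M b (\<pi> a) f g))"

definition poisson_lie_group ::
    "'g monoid \<Rightarrow> ('g, 'e::euclidean_space) mfd \<Rightarrow> ('g \<Rightarrow> 'g tensor2) \<Rightarrow> bool" where
  "poisson_lie_group G M \<pi> \<longleftrightarrow>
     lie_group G M \<and> poisson_structure M \<pi> \<and> multiplicative G M \<pi>"

definition closed_subgroup ::
    "'g set \<Rightarrow> 'g monoid \<Rightarrow> ('g, 'e::euclidean_space) mfd \<Rightarrow> bool" where
  "closed_subgroup K G M \<longleftrightarrow> subgroup K G \<and> closedin (mfd_top M) K"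

definition conj_subgroup :: "'g monoid \<Rightarrow> 'g \<Rightarrow> 'g set \<Rightarrow> 'g set" where
  "conj_subgroup G \<sigma> H = (\<lambda>h. \<sigma> \<otimes>\<^bsub>G\<^esub> h \<otimes>\<^bsub>G\<^esub> inv\<^bsub>G\<^esub> \<sigma>) ` H"

definition velocity ::
    "('a, 'e::euclidean_space) mfd \<Rightarrow> (real \<Rightarrow> 'a) \<Rightarrow> ('a \<Rightarrow> real) \<Rightarrow> real" where
  "velocity M \<gamma> = (\<lambda>f. if f \<in> smooth_funs M then deriv (f \<circ> \<gamma>) 0 else 0)"

text \<open>The Lie algebra of a closed subgroup \<open>K\<close>, as a subspace of \<open>\<gg> = T\<^sub>eG\<close>: the initial velocities
  of the one-parameter subgroups of \<open>G\<close> that are contained in \<open>K\<close>, i.e. those \<open>X\<close> with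
  \<open>exp (t X) \<in> K\<close> for all real \<open>t\<close>.\<close>

definition subgroup_lie_algebra ::
    "'g monoid \<Rightarrow> ('g, 'e::euclidean_space) mfd \<Rightarrow> 'g set \<Rightarrow> (('g \<Rightarrow> real) \<Rightarrow> real) set" where
  "subgroup_lie_algebra G M K =
     {velocity M \<gamma> | \<gamma>.
        smooth_map (euclidean_mfd :: (real, real) mfd) M \<gamma> \<and>
        (\<forall>s t. \<gamma> (s + t) = \<gamma> s \<otimes>\<^bsub>G\<^esub> \<gamma> t) \<and> (\<forall>t. \<gamma> t \<in> K)}"

definition coisotropic_subgroup ::
    "'g monoid \<Rightarrow> ('g, 'e::euclidean_space) mfd \<Rightarrow> ('g \<Rightarrow> 'g tensor2) \<Rightarrow> 'g set \<Rightarrow> bool" where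
  "coisotropic_subgroup G M \<pi> K \<longleftrightarrow>
     closed_subgroup K G M \<and>
     (\<forall>k\<in>K. \<pi> k \<in>
        left_transl G M k ` wedge_span (subgroup_lie_algebra G M K) (tangent_space M \<one>\<^bsub>G\<^esub>))"

definition affine_translate ::
    "'g monoid \<Rightarrow> ('g, 'e::euclidean_space) mfd \<Rightarrow> 'g \<Rightarrow> ('g \<Rightarrow> 'g tensor2) \<Rightarrow> 'g \<Rightarrow> 'g tensor2"
where
  "affine_translate G M \<sigma> \<pi> = (\<lambda>g. right_transl G M \<sigma> (\<pi> (g \<otimes>\<^bsub>G\<^esub> inv\<^bsub>G\<^esub> \<sigma>)))"

section \<open>Homogeneous spaces\<close>

definition coset_proj :: "'g monoid \<Rightarrow> 'g set \<Rightarrow> 'g \<Rightarrow> 'g set" where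
  "coset_proj G H = (\<lambda>g. g <#\<^bsub>G\<^esub> H)"

text \<open>The quotient topology on \<open>G/H\<close>; \<open>\<Union>U\<close> is the preimage of a set \<open>U\<close> of left cosets.\<close>

definition coset_topology :: "'g monoid \<Rightarrow> 'g set \<Rightarrow> 'g topology \<Rightarrow> 'g set topology" where
  "coset_topology G H X = topology (\<lambda>U. U \<subseteq> lcosets\<^bsub>G\<^esub> H \<and> openin X (\<Union>U))"

text \<open>\<open>G/H\<close> carries the unique smooth structure for which the projection is a submersion.
  Its maximal atlas consists of all charts of the quotient topology in which the projection
  is a submersion.\<close>

definition homogeneous_space ::
    "'g monoid \<Rightarrow> 'g set \<Rightarrow> ('g, 'e::euclidean_space) mfd \<Rightarrow> ('g set, 'e) mfd" where
  "homogeneous_space G H M =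
     \<lparr>mfd_top = coset_topology G H (mfd_top M),
      mfd_atlas = {d. is_chart (coset_topology G H (mfd_top M)) d \<and>
                      (\<forall>c\<in>mfd_atlas M. submersive_in_charts c d (coset_proj G H))}\<rparr>"

lemma openin_coset_topology:
  assumes "group G" "subgroup H G"
  shows "openin (coset_topology G H X) U \<longleftrightarrow> U \<subseteq> lcosets\<^bsub>G\<^esub> H \<and> openin X (\<Union>U)"
proof -
  have disj: "A = B" if "A \<in> lcosets\<^bsub>G\<^esub> H" "B \<in> lcosets\<^bsub>G\<^esub> H" "x \<in> A" "x \<in> B" for A B x
    using group.lcos_disjoint[OF assms] that unfolding pairwise_def disjnt_def by blast
  have inter: "\<Union>(S \<inter> T) = \<Union>S \<inter> \<Union>T" if "S \<subseteq> lcosets\<^bsub>G\<^esub> H" "T \<subseteq> lcosets\<^bsub>G\<^esub> H" for S T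
  proof
    show "\<Union>S \<inter> \<Union>T \<subseteq> \<Union>(S \<inter> T)"
    proof
      fix x assume "x \<in> \<Union>S \<inter> \<Union>T"
      then obtain A B where AB: "A \<in> S" "B \<in> T" "x \<in> A" "x \<in> B" by blast
      then have "A = B" using that by (intro disj[of A B x]) (erule (1) subsetD | assumption)+
      then show "x \<in> \<Union>(S \<inter> T)" using AB by blast
    qed
  qed blast
  have "istopology (\<lambda>U. U \<subseteq> lcosets\<^bsub>G\<^esub> H \<and> openin X (\<Union>U))"
    unfolding istopology_def
  proof (intro conjI allI impI)
    fix S T
    assume "S \<subseteq> lcosets\<^bsub>G\<^esub> H \<and> openin X (\<Union>S)" "T \<subseteq> lcosets\<^bsub>G\<^esub> H \<and> openin X (\<Union>T)"
    then show "S \<inter> T \<subseteq> lcosets\<^bsub>G\<^esub> H" "openin X (\<Union>(S \<inter> T))"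
      using inter[of S T] by (blast, metis openin_Int)
  next
    fix K
    assume K: "\<forall>U\<in>K. U \<subseteq> lcosets\<^bsub>G\<^esub> H \<and> openin X (\<Union>U)"
    then show "\<Union>K \<subseteq> lcosets\<^bsub>G\<^esub> H" by blast
    have "\<Union>(\<Union>K) = \<Union>(Union ` K)" by blast
    moreover have "openin X (\<Union>(Union ` K))"
      using K by (intro openin_Union) blast
    ultimately show "openin X (\<Union>(\<Union>K))" by (rule ssubst)
  qed
  then show ?thesis
    unfolding coset_topology_def by (simp only: topology_inverse')
qed

end

theory Submission
  imports Defs
begin

text \<open>
  The diffeomorphism \<open>G/H \<rightarrow> G/H\<^sub>\<sigma>\<close> is induced by right translation by \<open>\<sigma>\<inverse>\<close>, since
  \<open>gH\<sigma>\<inverse> = (g\<sigma>\<inverse>)H\<^sub>\<sigma>\<close>, and the same translation carries \<open>\<pi>\<^sub>\<sigma>(g)\<close> to \<open>\<pi>(g\<sigma>\<inverse>)\<close>.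
  If \<open>f\<close> and \<open>g\<close> are right \<open>H\<^sub>\<sigma>\<close>-invariant, multiplicativity gives
  \<open>\<pi>(xk) = L\<^sub>x\<pi>(k) + R\<^sub>k\<pi>(x)\<close>, and the first term annihilates \<open>(f, g)\<close> because \<open>f\<close> and \<open>g\<close> are constant
  along the one-parameter subgroups of \<open>H\<^sub>\<sigma>\<close>; so \<open>\<pi>\<close> projects.

  A right translation preserves submersions and hence pulls charts of \<open>G/H\<^sub>\<sigma>\<close> back to charts of
  \<open>G/H\<close>.  Smoothness therefore reduces to the compatibility of any two charts of \<open>G/H\<close>, which follows
  from smooth local sections of submersions.  That \<open>G/H\<close> is covered by charts
  is never needed: a 2-tensor vanishes on functions whose pullback to \<open>G\<close> is not smooth.
\<close>

section \<open>Calculus of \<open>C\<^sup>k\<close> maps\<close>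

text \<open>Two features of the encoding shape the proof. Model spaces are linear subspaces that may
  be proper, so a chart expression is controlled only on a relatively open set; its derivative there
  is determined only along the subspace, and chain-rule arguments have to stay inside it. Functions
  on a manifold are total on the type, and tensors take them as arguments, so replacing a function
  by one that agrees with it on the carrier needs a justification, which the Leibniz rule provides.

  The charts of \<open>G/H\<close> are selected by the submersivity of the projection, so the
  compatibility of two of them is a statement to be proved. The local section used for it is a
  restricted local inverse, and here lies the analytic core: \<open>inverse_function_theorem\<close>
  supplies an inverse with a derivative at each point, and its higher regularity is bootstrapped
  from the way the inverse of the derivative varies with the point.\<close>

lemma Ck_on_cong:
  assumes "open S" "\<And>x. x \<in> S \<Longrightarrow> f x = g x" "Ck_on k S f"
  shows "Ck_on k S g"
  using assms(2,3)
proof (induction k arbitrary: f g)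
  case 0
  then show ?case using continuous_on_cong[OF refl, of S f g] by simp
next
  case (Suc k)
  \<comment> \<open>Derivatives are taken over full neighbourhoods, so equality on \<open>S\<close>
    carries over to them because \<open>S\<close> is open.\<close>
  have deriv: "g differentiable (at x) \<and> frechet_derivative f (at x) = frechet_derivative g (at x)"
    if "x \<in> S" for x
  proof -
    have *: "f differentiable (at x)" using Suc.prems that by simp
    then have "(f has_derivative frechet_derivative f (at x)) (at x)"
      by (simp add: frechet_derivative_works)
    then have "(g has_derivative frechet_derivative f (at x)) (at x)"
      by (rule has_derivative_transform_within_open[OF _ assms(1) that Suc.prems(1)])
    then show ?thesis using frechet_derivative_at differentiableI by blast
  qed
  have "Ck_on k S (\<lambda>x. frechet_derivative g (at x) v)" for v
    by (rule Suc.IH[of "\<lambda>x. frechet_derivative f (at x) v"]) (use deriv Suc.prems in auto)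
  then show ?case using deriv by simp
qed

lemma Ck_on_subset: "Ck_on k S f \<Longrightarrow> T \<subseteq> S \<Longrightarrow> Ck_on k T f"
  by (induction k arbitrary: f) (auto intro: continuous_on_subset)

text \<open>Replaces the chosen \<open>frechet_derivative\<close> by any explicit formula
  \<open>f'\<close>, so that the calculus rules below can be proved by induction on the
  order.\<close>

lemma Ck_on_SucI:
  assumes "open S" "\<And>x. x \<in> S \<Longrightarrow> (f has_derivative f' x) (at x)"
    "\<And>v. Ck_on k S (\<lambda>x. f' x v)"
  shows "Ck_on (Suc k) S f"
proof -
  have eq: "frechet_derivative f (at x) = f' x" if "x \<in> S" for x
    using frechet_derivative_at[OF assms(2)[OF that]] by simp
  have "Ck_on k S (\<lambda>x. frechet_derivative f (at x) v)" for v
    by (rule Ck_on_cong[OF assms(1) _ assms(3)[of v]]) (simp add: eq)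
  then show ?thesis using assms(2) by (auto simp: differentiable_def)
qed

lemma Ck_on_has_derivative:
  "Ck_on (Suc k) S f \<Longrightarrow> x \<in> S \<Longrightarrow> (f has_derivative frechet_derivative f (at x)) (at x)"
  by (simp add: frechet_derivative_works)

lemma Ck_on_continuous: "Ck_on k S f \<Longrightarrow> continuous_on S f"
  by (cases k)
    (auto intro!: continuous_at_imp_continuous_on dest: differentiable_imp_continuous_within)

lemma Ck_on_SucD: "Ck_on (Suc k) S f \<Longrightarrow> Ck_on k S f"
proof (induction k arbitrary: f)
  case 0
  show ?case using Ck_on_continuous[OF 0] by simp
next
  case (Suc k)
  then have "Ck_on k S (\<lambda>x. frechet_derivative f (at x) v)" for v
    using Ck_on.simps(2)[of "Suc k" S f] by blast
  then show ?case using Suc.prems by simp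
qed

lemma Ck_on_const: "open S \<Longrightarrow> Ck_on k S (\<lambda>x. c)"
proof (induction k arbitrary: c)
  case (Suc k)
  then show ?case by (intro Ck_on_SucI[where f' = "\<lambda>x v. 0"]) auto
qed auto

lemma Ck_on_bounded_linear:
  assumes "open S" "bounded_linear L"
  shows "Ck_on k S L"
proof (cases k)
  case 0
  then show ?thesis using assms by (simp add: linear_continuous_on)
next
  case (Suc j)
  have "Ck_on (Suc j) S L"
    by (rule Ck_on_SucI[where f' = "\<lambda>x. L"])
      (use assms in \<open>auto intro: bounded_linear_imp_has_derivative Ck_on_const\<close>)
  then show ?thesis using Suc by simp
qed

lemma Ck_on_bounded_linear_comp:
  assumes "open S" "bounded_linear L" "Ck_on k S f"
  shows "Ck_on k S (\<lambda>x. L (f x))"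
  using assms(3)
proof (induction k arbitrary: f)
  case 0
  then show ?case using assms(2) by (simp add: bounded_linear.continuous_on)
next
  case (Suc k)
  show ?case
    by (rule Ck_on_SucI[where f' = "\<lambda>x v. L (frechet_derivative f (at x) v)"])
      (use assms(1) Suc Ck_on_has_derivative[OF Suc.prems] in
        \<open>auto intro: bounded_linear.has_derivative[OF assms(2)]\<close>)
qed

lemma Ck_on_add:
  assumes "open S" "Ck_on k S f" "Ck_on k S g"
  shows "Ck_on k S (\<lambda>x. f x + g x)"
  using assms(2,3)
proof (induction k arbitrary: f g)
  case 0
  then show ?case by (simp add: continuous_on_add)
next
  case (Suc k)
  show ?case
    by (rule Ck_on_SucI[where
          f' = "\<lambda>x v. frechet_derivative f (at x) v + frechet_derivative g (at x) v"])
      (use assms(1) Suc Ck_on_has_derivative[OF Suc.prems(1)] Ck_on_has_derivative[OF Suc.prems(2)]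
        in \<open>auto intro: has_derivative_add\<close>)
qed

lemma Ck_on_sum:
  assumes "open S" "\<And>i. i \<in> I \<Longrightarrow> Ck_on k S (f i)"
  shows "Ck_on k S (\<lambda>x. \<Sum>i\<in>I. f i x)"
proof (cases "finite I")
  case True
  then show ?thesis using assms(2)
    by (induction I rule: finite_induct) (auto simp: Ck_on_const Ck_on_add assms(1))
qed (simp add: Ck_on_const assms(1))

lemma Ck_on_scaleR:
  fixes f :: "'a::euclidean_space \<Rightarrow> real"
  assumes "open S" "Ck_on k S f" "Ck_on k S g"
  shows "Ck_on k S (\<lambda>x. f x *\<^sub>R g x)"
  using assms(2,3)
proof (induction k arbitrary: f g)
  case 0
  then show ?case by (simp add: continuous_on_scaleR)
next
  case (Suc k)
  let ?f' = "\<lambda>x v. f x *\<^sub>R frechet_derivative g (at x) v + frechet_derivative f (at x) v *\<^sub>R g x"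
  show ?case
  proof (rule Ck_on_SucI[where f' = ?f'])
    show "((\<lambda>x. f x *\<^sub>R g x) has_derivative ?f' x) (at x)" if "x \<in> S" for x
      by (intro has_derivative_scaleR Ck_on_has_derivative[OF Suc.prems(1) that]
          Ck_on_has_derivative[OF Suc.prems(2) that])
    show "Ck_on k S (\<lambda>x. ?f' x v)" for v
      using Suc.prems Ck_on_SucD[OF Suc.prems(1)] Ck_on_SucD[OF Suc.prems(2)]
      by (intro Ck_on_add[OF assms(1)] Suc.IH) auto
  qed fact
qed

lemma Ck_on_inner:
  assumes "open S" "Ck_on k S f"
  shows "Ck_on k S (\<lambda>x. f x \<bullet> b)"
  by (rule Ck_on_bounded_linear_comp[OF assms(1) bounded_linear_inner_left assms(2)])

lemma linear_euclidean_expansion: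
  fixes L :: "'a::euclidean_space \<Rightarrow> 'b::real_vector"
  assumes "linear L"
  shows "L x = (\<Sum>b\<in>Basis. (x \<bullet> b) *\<^sub>R L b)"
proof -
  have "L x = L (\<Sum>b\<in>Basis. (x \<bullet> b) *\<^sub>R b)" by (simp add: euclidean_representation)
  then show ?thesis using assms by (simp add: linear_sum linear_cmul)
qed

lemma Ck_on_compose:
  assumes "open S" "open T" "f ` S \<subseteq> T" "Ck_on k S f" "Ck_on k T g"
  shows "Ck_on k S (\<lambda>x. g (f x))"
  using assms(4,5)
proof (induction k arbitrary: g)
  case 0
  then show ?case using assms(3) continuous_on_compose2[of T g S f] by simp
next
  case (Suc k)
  \<comment> \<open>Expanding the inner derivative in the basis turns the chain rule into a finite
    sum of scalar functions times partial derivatives of \<open>g\<close>, to which the sum and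
    product rules apply.\<close>
  let ?d = "\<lambda>x v. \<Sum>b\<in>Basis. (frechet_derivative f (at x) v \<bullet> b) *\<^sub>R frechet_derivative g (at (f x)) b"
  show ?case
  proof (rule Ck_on_SucI[where f' = ?d])
    fix x assume x: "x \<in> S"
    have g: "(g has_derivative frechet_derivative g (at (f x))) (at (f x))"
      using x assms(3) Ck_on_has_derivative[OF Suc.prems(2)] by blast
    have "((\<lambda>x. g (f x)) has_derivative
        (\<lambda>v. frechet_derivative g (at (f x)) (frechet_derivative f (at x) v))) (at x)"
      by (rule has_derivative_compose[OF Ck_on_has_derivative[OF Suc.prems(1) x] g])
    then show "((\<lambda>x. g (f x)) has_derivative ?d x) (at x)"
      by (simp add: linear_euclidean_expansion[OF has_derivative_linear[OF g], symmetric])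
  next
    show "Ck_on k S (\<lambda>x. ?d x v)" for v
    proof (intro Ck_on_sum Ck_on_scaleR assms(1) Ck_on_inner)
      show "Ck_on k S (\<lambda>x. frechet_derivative f (at x) v)" using Suc.prems by simp
      show "Ck_on k S (\<lambda>x. frechet_derivative g (at (f x)) b)" for b
        using Suc.IH[OF Ck_on_SucD[OF Suc.prems(1)], of "\<lambda>y. frechet_derivative g (at y) b"] Suc.prems
        by simp
    qed
  qed fact
qed

lemma Ck_on_Pair:
  assumes "open S" "Ck_on k S f" "Ck_on k S g"
  shows "Ck_on k S (\<lambda>x. (f x, g x))"
proof -
  have "Ck_on k S (\<lambda>x. (f x, 0) + (0, g x))"
    by (intro Ck_on_add assms Ck_on_bounded_linear_comp[of S "\<lambda>y. (y, 0)"]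
        Ck_on_bounded_linear_comp[of S "\<lambda>y. (0, y)"])
      (auto intro: bounded_linear_Pair bounded_linear_ident bounded_linear_zero)
  then show ?thesis by simp
qed

section \<open>Higher regularity of local inverses\<close>

text \<open>At a zero of \<open>f\<close> the error of the product splits into
  \<open>f(x+h) - f' h\<close> times \<open>g(x+h)\<close> and \<open>f' h\<close> times
  \<open>g(x+h) - g x\<close>. Both are of smaller order than \<open>h\<close> when \<open>g\<close>
  is merely continuous. This differentiates the inverse Jacobian, which at that stage is only known
  to be continuous.\<close>

lemma has_derivative_scaleR_zero_continuous:
  fixes f :: "'a::real_normed_vector \<Rightarrow> real" and g :: "'a \<Rightarrow> 'b::real_normed_vector"
  assumes "(f has_derivative f') (at x)" "f x = 0" "isCont g x"
  shows "((\<lambda>y. f y *\<^sub>R g y) has_derivative (\<lambda>h. f' h *\<^sub>R g x)) (at x)"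
proof -
  interpret f': bounded_linear f' by (rule has_derivative_bounded_linear[OF assms(1)])
  obtain K where K: "\<And>h. norm (f' h) \<le> norm h * K" using f'.bounded by blast
  have f: "((\<lambda>h. norm (f (x + h) - f' h) / norm h) \<longlongrightarrow> 0) (at 0)"
    using assms(1,2) unfolding has_derivative_at by simp
  have g: "((\<lambda>h. g (x + h)) \<longlongrightarrow> g x) (at 0)"
    using assms(3) by (simp add: isCont_def LIM_offset_zero_iff)
  have lim: "((\<lambda>h. norm (f (x + h) - f' h) / norm h * norm (g (x + h))
      + \<bar>K\<bar> * norm (g (x + h) - g x)) \<longlongrightarrow> 0) (at 0)"
    by (rule tendsto_eq_intros f g refl)+ simp
  have "((\<lambda>h. norm (f (x + h) *\<^sub>R g (x + h) - f x *\<^sub>R g x - f' h *\<^sub>R g x) / norm h) \<longlongrightarrow> 0) (at 0)"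
  proof (rule Lim_null_comparison[OF _ lim], rule always_eventually, rule allI)
    fix h :: 'a
    have "f (x + h) *\<^sub>R g (x + h) - f x *\<^sub>R g x - f' h *\<^sub>R g x
        = (f (x + h) - f' h) *\<^sub>R g (x + h) + f' h *\<^sub>R (g (x + h) - g x)"
      using assms(2) by (simp add: algebra_simps)
    then have "norm (f (x + h) *\<^sub>R g (x + h) - f x *\<^sub>R g x - f' h *\<^sub>R g x)
        \<le> norm (f (x + h) - f' h) * norm (g (x + h)) + norm (f' h) * norm (g (x + h) - g x)"
      by (metis norm_scaleR norm_triangle_ineq real_norm_def)
    also have "\<dots> \<le> norm (f (x + h) - f' h) * norm (g (x + h))
        + (norm h * \<bar>K\<bar>) * norm (g (x + h) - g x)"
      by (intro add_left_mono mult_right_mono order_trans[OF K] mult_left_mono) auto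
    finally show "norm (norm (f (x + h) *\<^sub>R g (x + h) - f x *\<^sub>R g x - f' h *\<^sub>R g x) / norm h)
      \<le> norm (f (x + h) - f' h) / norm h * norm (g (x + h)) + \<bar>K\<bar> * norm (g (x + h) - g x)"
      by (cases "h = 0") (simp_all add: field_simps)
  qed
  then show ?thesis
    unfolding has_derivative_at
    using bounded_linear_compose[OF bounded_linear_scaleR_left f'.bounded_linear_axioms] by blast
qed

text \<open>\<open>J z\<close> is the inverse of the derivative of \<open>H\<close> at
  \<open>K z\<close>. The uniform bound makes \<open>J\<close> continuous; continuity then gives it
  a derivative, the usual \<open>- J H''(J b, J h)\<close>. This formula is polynomial in
  \<open>J\<close> and in derivatives of \<open>H\<close> along \<open>K\<close>, so each order of
  regularity yields the next.\<close>

lemma Ck_on_inverse: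
  fixes H K :: "'a::euclidean_space \<Rightarrow> 'a"
  assumes "open U" "open V" "K ` V \<subseteq> U" "\<And>k. Ck_on k U H"
    and K: "\<And>z. z \<in> V \<Longrightarrow> (K has_derivative J z) (at z)"
    and right: "\<And>z b. z \<in> V \<Longrightarrow> frechet_derivative H (at (K z)) (J z b) = b"
    and left: "\<And>z b. z \<in> V \<Longrightarrow> J z (frechet_derivative H (at (K z)) b) = b"
    and bound: "\<And>z b. z \<in> V \<Longrightarrow> norm (J z b) \<le> B * norm b"
  shows "Ck_on k V K"
proof -
  define A where "A b x = frechet_derivative H (at x) b" for b x
  define A2 where "A2 b c x = frechet_derivative (A b) (at x) c" for b c x
  have A: "Ck_on k U (A b)" for k b
    using assms(4)[of "Suc k"] unfolding A_def by simp
  have A2: "Ck_on k U (A2 b c)" for k b c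
    using A[of "Suc k" b] unfolding A2_def by simp
  have linJ: "linear (J z)" if "z \<in> V" for z
    using has_derivative_linear[OF K[OF that]] .
  have dA: "((\<lambda>z. A w (K z)) has_derivative (\<lambda>h. A2 w (J z h) (K z))) (at z)"
    if "z \<in> V" for z w
    unfolding A2_def
    using has_derivative_compose[OF K[OF that] Ck_on_has_derivative[OF A[of "Suc 0"]]] that assms(3)
    by blast
  \<comment> \<open>Applying \<open>J z'\<close> to the derivative of \<open>H\<close> at
    \<open>K z'\<close> in direction \<open>J z b\<close> returns \<open>J z b\<close>. So the
    variation of \<open>J\<close> is controlled by the defect \<open>A (J z b) (K z') - b\<close>,
    which vanishes at \<open>z' = z\<close>.\<close>
  have diff: "J z' b = J z b - J z' (A (J z b) (K z') - b)" if "z \<in> V" "z' \<in> V" for z z' b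
    using left[OF that(2)] linear_diff[OF linJ[OF that(2)]] by (simp add: A_def)
  have contJ: "isCont (\<lambda>z. J z b) z" if z: "z \<in> V" for z b
  proof -
    have "isCont (\<lambda>z'. A (J z b) (K z')) z"
      using has_derivative_continuous[OF dA[OF z]] .
    moreover have "A (J z b) (K z) = b" using right[OF z] by (simp add: A_def)
    ultimately have "((\<lambda>z'. A (J z b) (K z') - b) \<longlongrightarrow> 0) (at z)"
      unfolding isCont_def using LIM_zero by fastforce
    then have "((\<lambda>z'. B * norm (A (J z b) (K z') - b)) \<longlongrightarrow> 0) (at z)"
      using tendsto_mult_right_zero tendsto_norm_zero by blast
    then have "((\<lambda>z'. J z' b - J z b) \<longlongrightarrow> 0) (at z)"
    proof (rule Lim_null_comparison[rotated])
      have "eventually (\<lambda>z'. z' \<in> V) (at z)"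
        using z assms(2) by (simp add: eventually_at_in_open')
      then show "\<forall>\<^sub>F z' in at z. norm (J z' b - J z b) \<le> B * norm (A (J z b) (K z') - b)"
      proof eventually_elim
        case (elim z')
        have "J z' b - J z b = - J z' (A (J z b) (K z') - b)" using diff[OF z elim, of b] by simp
        then show ?case using bound[OF elim] by (metis norm_minus_cancel)
      qed
    qed
    then show ?thesis unfolding isCont_def using LIM_zero_iff by blast
  qed
  have derJ: "((\<lambda>z. J z b) has_derivative (\<lambda>h. - J z (A2 (J z b) (J z h) (K z)))) (at z)"
    if z: "z \<in> V" for z b
  proof -
    \<comment> \<open>Since \<open>m\<close> vanishes at \<open>z\<close>, each term in the basis
      expansion of \<open>J z' (m z')\<close> is a differentiable zero times a continuous
      factor.\<close>
    define m where "m z' = A (J z b) (K z') - b" for z'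
    have m0: "m z = 0" using right[OF z] by (simp add: m_def A_def)
    have dm: "(m has_derivative (\<lambda>h. A2 (J z b) (J z h) (K z))) (at z)"
      unfolding m_def using has_derivative_diff[OF dA[OF z] has_derivative_const, of "J z b" b] by simp
    have "((\<lambda>z'. (m z' \<bullet> c) *\<^sub>R J z' c) has_derivative
        (\<lambda>h. (A2 (J z b) (J z h) (K z) \<bullet> c) *\<^sub>R J z c)) (at z)" for c
      by (rule has_derivative_scaleR_zero_continuous[OF has_derivative_inner_left[OF dm] _ contJ[OF z]])
        (simp add: m0)
    then have "((\<lambda>z'. J z b - (\<Sum>c\<in>Basis. (m z' \<bullet> c) *\<^sub>R J z' c)) has_derivative
        (\<lambda>h. 0 - (\<Sum>c\<in>Basis. (A2 (J z b) (J z h) (K z) \<bullet> c) *\<^sub>R J z c))) (at z)"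
      by (intro has_derivative_diff has_derivative_const has_derivative_sum)
    then have "((\<lambda>z'. J z b - (\<Sum>c\<in>Basis. (m z' \<bullet> c) *\<^sub>R J z' c)) has_derivative
        (\<lambda>h. - J z (A2 (J z b) (J z h) (K z)))) (at z)"
      by (simp add: linear_euclidean_expansion[OF linJ[OF z], symmetric])
    then show ?thesis
    proof (rule has_derivative_transform_within_open[OF _ assms(2) z])
      show "J z b - (\<Sum>c\<in>Basis. (m z' \<bullet> c) *\<^sub>R J z' c) = J z' b" if "z' \<in> V" for z'
        using diff[OF z that, of b] linear_euclidean_expansion[OF linJ[OF that], of "m z'"]
        by (simp add: m_def)
    qed
  qed
  \<comment> \<open>\<open>K\<close> and \<open>J\<close> are raised together: the derivative of
    \<open>K\<close> is \<open>J\<close>, and that of \<open>J\<close> involves both.\<close>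
  have "Ck_on k V K \<and> (\<forall>b. Ck_on k V (\<lambda>z. J z b))"
  proof (induction k)
    case 0
    have "isCont K z" if "z \<in> V" for z using has_derivative_continuous[OF K[OF that]] .
    then show ?case using contJ by (simp add: continuous_at_imp_continuous_on)
  next
    case (Suc k)
    have linA: "A w x = (\<Sum>d\<in>Basis. (w \<bullet> d) *\<^sub>R A d x)" if "x \<in> U" for w x
      unfolding A_def
      using linear_euclidean_expansion[OF has_derivative_linear[OF Ck_on_has_derivative[OF assms(4) that]]] .
    \<comment> \<open>\<open>A2\<close> differentiates \<open>A w\<close> with \<open>w\<close> held
      fixed, so its linearity in \<open>w\<close> comes from differentiating the expansion
      \<open>linA\<close>. It is needed because the direction \<open>w = J z b\<close> moves with
      \<open>z\<close>.\<close>
    have linA2: "A2 w h x = (\<Sum>d\<in>Basis. (w \<bullet> d) *\<^sub>R (\<Sum>e\<in>Basis. (h \<bullet> e) *\<^sub>R A2 d e x))"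
      if x: "x \<in> U" for w h x
    proof -
      have dA: "(A d has_derivative (\<lambda>h. A2 d h x)) (at x)" for d
        using Ck_on_has_derivative[OF A x] unfolding A2_def .
      have "((\<lambda>x. \<Sum>d\<in>Basis. (w \<bullet> d) *\<^sub>R A d x) has_derivative
          (\<lambda>h. \<Sum>d\<in>Basis. (w \<bullet> d) *\<^sub>R A2 d h x)) (at x)"
        by (intro has_derivative_sum has_derivative_scaleR_right dA)
      then have "(A w has_derivative (\<lambda>h. \<Sum>d\<in>Basis. (w \<bullet> d) *\<^sub>R A2 d h x)) (at x)"
        by (rule has_derivative_transform_within_open[OF _ assms(1) x]) (simp add: linA)
      then have "A2 w h x = (\<Sum>d\<in>Basis. (w \<bullet> d) *\<^sub>R A2 d h x)"
        using has_derivative_unique[OF dA[of w]] by metis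
      also have "\<dots> = (\<Sum>d\<in>Basis. (w \<bullet> d) *\<^sub>R (\<Sum>e\<in>Basis. (h \<bullet> e) *\<^sub>R A2 d e x))"
        using linear_euclidean_expansion[OF has_derivative_linear[OF dA]]
        by (intro sum.cong refl arg_cong2[where f = scaleR]) blast
      finally show ?thesis .
    qed
    have "Ck_on (Suc k) V (\<lambda>z. J z b)" for b
    proof (rule Ck_on_SucI[OF assms(2) derJ])
      fix h
      let ?m = "\<lambda>z. \<Sum>d\<in>Basis. (J z b \<bullet> d) *\<^sub>R (\<Sum>e\<in>Basis. (J z h \<bullet> e) *\<^sub>R A2 d e (K z))"
      have "Ck_on k V (\<lambda>z. - (\<Sum>c\<in>Basis. (?m z \<bullet> c) *\<^sub>R J z c))"
      proof -
        have *: "Ck_on k V (\<lambda>z. J z b)" for b using Suc by blast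
        have **: "Ck_on k V (\<lambda>z. A2 d e (K z))" for d e
          using Ck_on_compose[OF assms(2,1,3) _ A2[of k d e]] Suc by blast
        have m: "Ck_on k V ?m"
          by (intro Ck_on_sum Ck_on_scaleR Ck_on_inner assms(2) * **)
        show ?thesis
          by (rule Ck_on_bounded_linear_comp[OF assms(2) bounded_linear_minus[OF bounded_linear_ident]])
            (intro Ck_on_sum Ck_on_scaleR Ck_on_inner m assms(2) *)
      qed
      then show "Ck_on k V (\<lambda>z. - J z (A2 (J z b) (J z h) (K z)))"
      proof (rule Ck_on_cong[OF assms(2), rotated])
        fix z assume z: "z \<in> V"
        then have "K z \<in> U" using assms(3) by blast
        then have "?m z = A2 (J z b) (J z h) (K z)" by (rule linA2[symmetric])
        then show "- (\<Sum>c\<in>Basis. (?m z \<bullet> c) *\<^sub>R J z c) = - J z (A2 (J z b) (J z h) (K z))"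
          by (simp only: linear_euclidean_expansion[OF linJ[OF z], symmetric])
      qed
    qed
    moreover have "Ck_on (Suc k) V K"
      by (rule Ck_on_SucI[OF assms(2) K]) (use Suc in auto)
    ultimately show ?case by blast
  qed
  then show ?thesis by blast
qed

lemma smooth_local_inverse:
  fixes H :: "'a::euclidean_space \<Rightarrow> 'a"
  assumes "open U" "v \<in> U" "\<And>k. Ck_on k U H" "(H has_derivative (\<lambda>h. h)) (at v)"
  obtains V K where "open V" "H v \<in> V" "\<And>k. Ck_on k V K" "K ` V \<subseteq> U"
    "\<And>z. z \<in> V \<Longrightarrow> H (K z) = z" "K (H v) = v"
proof -
  define f' where "f' x = Blinfun (frechet_derivative H (at x))" for x
  have dH: "(H has_derivative frechet_derivative H (at x)) (at x)" if "x \<in> U" for x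
    using Ck_on_has_derivative[OF assms(3) that] .
  have f': "blinfun_apply (f' x) = frechet_derivative H (at x)" if "x \<in> U" for x
    unfolding f'_def
    by (rule bounded_linear_Blinfun_apply[OF has_derivative_bounded_linear[OF dH[OF that]]])
  have cont: "continuous_on U f'"
  proof (rule continuous_on_blinfun_componentwise)
    fix i
    have "continuous_on U (\<lambda>x. frechet_derivative H (at x) i)"
      using assms(3)[of 1] by simp
    then show "continuous_on U (\<lambda>x. blinfun_apply (f' x) i)"
      by (rule continuous_on_eq) (simp add: f')
  qed
  have f'v: "f' v = id_blinfun"
    using frechet_derivative_at[OF assms(4)] f'[OF assms(2)] by (intro blinfun_eqI) simp
  \<comment> \<open>On \<open>U0\<close> the derivative is within 1/2 of the identity, so
    \<open>b\<close> and \<open>J z b\<close> differ by at most half the norm of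
    \<open>J z b\<close>. This gives the bound 2 for \<open>J\<close>, uniformly on
    \<open>V\<close>, as \<open>Ck_on_inverse\<close> requires.\<close>
  define U0 where "U0 = {x \<in> U. norm (f' x - id_blinfun) < 1/2}"
  have "open (U \<inter> (\<lambda>x. norm (f' x - id_blinfun)) -` {..<1/2})"
    by (rule continuous_open_preimage)
      (use cont assms(1) in \<open>auto intro!: continuous_on_norm continuous_on_diff\<close>)
  also have "U \<inter> (\<lambda>x. norm (f' x - id_blinfun)) -` {..<1/2} = U0"
    unfolding U0_def by auto
  finally have "open U0" .
  have "U0 \<subseteq> U" and "v \<in> U0" using assms(2) by (auto simp: U0_def f'v)
  have dH0: "(H has_derivative blinfun_apply (f' x)) (at x)" if "x \<in> U0" for x
    using dH f' that \<open>U0 \<subseteq> U\<close> by auto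
  have contU0: "continuous_on U0 f'" using cont \<open>U0 \<subseteq> U\<close> by (rule continuous_on_subset)
  have inv_v: "id_blinfun o\<^sub>L f' v = id_blinfun" by (rule blinfun_eqI) (simp add: f'v)
  obtain U' V K J where V: "open U'" "U' \<subseteq> U0" "v \<in> U'" "open V" "H v \<in> V" "homeomorphism U' V H K"
    "\<And>z. z \<in> V \<Longrightarrow> (K has_derivative (J z)) (at z)"
    "\<And>z. z \<in> V \<Longrightarrow> J z = inv_into UNIV (blinfun_apply (f' (K z)))"
    "\<And>z. z \<in> V \<Longrightarrow> bij (blinfun_apply (f' (K z)))"
    by (rule inverse_function_theorem[OF \<open>open U0\<close> dH0 contU0 \<open>v \<in> U0\<close> inv_v]) (assumption, rule that)
  have K: "K z \<in> U0" "H (K z) = z" if "z \<in> V" for z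
    using V(6,2) that unfolding homeomorphism_def by auto
  have KU: "K z \<in> U" if "z \<in> V" for z using K[OF that] \<open>U0 \<subseteq> U\<close> by blast
  have right: "frechet_derivative H (at (K z)) (J z b) = b" if "z \<in> V" for z b
    using V(8,9)[OF that] f'[OF KU[OF that]] by (metis bij_inv_eq_iff)
  have left: "J z (frechet_derivative H (at (K z)) b) = b" if "z \<in> V" for z b
    using V(8,9)[OF that] f'[OF KU[OF that]] by (metis bij_inv_eq_iff)
  have bound: "norm (J z b) \<le> 2 * norm b" if z: "z \<in> V" for z b
  proof -
    have "norm (b - J z b) = norm (blinfun_apply (f' (K z) - id_blinfun) (J z b))"
      using right[OF z] f'[OF KU[OF z]] by (simp add: blinfun.diff_left)
    also have "\<dots> \<le> norm (f' (K z) - id_blinfun) * norm (J z b)" by (rule norm_blinfun)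
    also have "\<dots> \<le> 1/2 * norm (J z b)"
      using K(1)[OF z] by (intro mult_right_mono) (auto simp: U0_def)
    finally show ?thesis using norm_triangle_sub[of "J z b" b] by (simp add: norm_minus_commute)
  qed
  have "Ck_on k V K" for k
    by (rule Ck_on_inverse[OF assms(1) V(4) _ assms(3) V(7) right left bound]) (use KU in auto)
  moreover have "K (H v) = v" using V(6,3) unfolding homeomorphism_def by auto
  ultimately show thesis using that V(4,5) KU K(2) by blast
qed

section \<open>Smooth maps and local sections of submersions\<close>

lemma smooth_on_subset: "smooth_on S f \<Longrightarrow> T \<subseteq> S \<Longrightarrow> smooth_on T f"
  unfolding smooth_on_def by (meson IntE IntI subsetD)

lemma smooth_on_cong: "smooth_on S f \<Longrightarrow> (\<And>x. x \<in> S \<Longrightarrow> f x = g x) \<Longrightarrow> smooth_on S g"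
  unfolding smooth_on_def by (metis IntD1)

lemma smooth_on_locally:
  assumes "\<And>x. x \<in> S \<Longrightarrow> \<exists>W. open W \<and> x \<in> W \<and> smooth_on (S \<inter> W) f"
  shows "smooth_on S f"
  unfolding smooth_on_def
proof
  fix x assume x: "x \<in> S"
  then obtain W where W: "open W" "x \<in> W" "smooth_on (S \<inter> W) f" using assms by blast
  then obtain W' g where W': "open W'" "x \<in> W'" "\<forall>k. Ck_on k W' g" "\<forall>y\<in>(S \<inter> W) \<inter> W'. g y = f y"
    using x unfolding smooth_on_def by blast
  show "\<exists>W g. open W \<and> x \<in> W \<and> (\<forall>k. Ck_on k W g) \<and> (\<forall>y\<in>S \<inter> W. g y = f y)"
    using W W' by (intro exI[of _ "W \<inter> W'"] exI[of _ g]) (auto intro: Ck_on_subset)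
qed

lemma smooth_on_Ck: "open S \<Longrightarrow> (\<And>k. Ck_on k S f) \<Longrightarrow> smooth_on S f"
  unfolding smooth_on_def by blast

lemma smooth_on_compose:
  assumes "smooth_on S f" "smooth_on T g" "f ` S \<subseteq> T"
  shows "smooth_on S (\<lambda>x. g (f x))"
  unfolding smooth_on_def
proof
  fix x assume x: "x \<in> S"
  obtain W f0 where f: "open W" "x \<in> W" "\<forall>k. Ck_on k W f0" "\<forall>y\<in>S \<inter> W. f0 y = f y"
    using assms(1) x unfolding smooth_on_def by blast
  have "f x \<in> T" using x assms(3) by blast
  then obtain W' g0 where g: "open W'" "f x \<in> W'" "\<forall>k. Ck_on k W' g0" "\<forall>y\<in>T \<inter> W'. g0 y = g y"
    using assms(2) unfolding smooth_on_def by blast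
  let ?V = "W \<inter> f0 -` W'"
  have "continuous_on W f0" using f(3) Ck_on_continuous by blast
  then have V: "open ?V" using f(1) g(1) by (rule continuous_open_preimage)
  have "Ck_on k ?V (\<lambda>y. g0 (f0 y))" for k
    by (rule Ck_on_compose[OF V g(1)]) (use f g in \<open>auto intro: Ck_on_subset\<close>)
  moreover have "f0 x = f x" using x f by auto
  ultimately show "\<exists>W h. open W \<and> x \<in> W \<and> (\<forall>k. Ck_on k W h) \<and> (\<forall>y\<in>S \<inter> W. h y = g (f y))"
    using f g V assms(3)
    by (intro exI[of _ ?V] exI[of _ "\<lambda>y. g0 (f0 y)"]) (auto simp: image_subset_iff)
qed

lemma smooth_on_Pair_const: "smooth_on S (\<lambda>x. (x, c))"
proof (rule smooth_on_subset[OF smooth_on_Ck])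
  show "Ck_on k UNIV (\<lambda>x. (x, c))" for k
    by (intro Ck_on_Pair Ck_on_const Ck_on_bounded_linear bounded_linear_ident open_UNIV)
qed auto

lemma smooth_on_has_derivative:
  assumes "smooth_on S f" "x \<in> S"
  obtains E where "(f has_derivative E) (at x within S)"
proof -
  obtain W g where W: "open W" "x \<in> W" "\<forall>k. Ck_on k W g" "\<forall>y\<in>S \<inter> W. g y = f y"
    using assms unfolding smooth_on_def by blast
  have "(g has_derivative frechet_derivative g (at x)) (at x within S)"
    using Ck_on_has_derivative[of 0 W g x] W by (blast intro: has_derivative_at_withinI)
  then have "(f has_derivative frechet_derivative g (at x)) (at x within S)"
    by (rule has_derivative_transform_eventually)
      (use W assms(2) in \<open>auto simp: eventually_at_topological\<close>)
  then show thesis by (rule that)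
qed

section \<open>Derivatives within relatively open subsets of a linear subspace\<close>

text \<open>Relative openness keeps \<open>u + t a\<close> in \<open>S\<close> for small
  \<open>t\<close> of either sign, so along a direction of the subspace the derivative within
  \<open>S\<close> becomes an ordinary derivative on the line. This is what determines
  \<open>E a\<close>.\<close>

lemma has_derivative_within_line:
  assumes "subspace A" "openin (top_of_set A) S" "u \<in> S" "a \<in> A"
    "(f has_derivative E) (at u within S)"
  shows "((\<lambda>t. f (u + t *\<^sub>R a)) has_vector_derivative E a) (at 0)"
proof -
  obtain W where W: "open W" "S = A \<inter> W" using assms(2) by (auto simp: openin_open)
  define N where "N = (\<lambda>t::real. u + t *\<^sub>R a) -` W"
  have "open N" unfolding N_def using W(1) by (intro open_vimage) (auto intro!: continuous_intros)
  have sub: "(\<lambda>t. u + t *\<^sub>R a) ` N \<subseteq> S"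
    using assms(1,3,4) W unfolding N_def by (auto intro: subspace_add subspace_scale)
  have "0 \<in> N" using assms(3) W unfolding N_def by simp
  have "((\<lambda>t. u + t *\<^sub>R a) has_derivative (\<lambda>t. t *\<^sub>R a)) (at 0 within N)"
    by (auto intro!: derivative_eq_intros)
  then have "((\<lambda>t. f (u + t *\<^sub>R a)) has_derivative (\<lambda>t. E (t *\<^sub>R a))) (at 0 within N)"
    by (rule has_derivative_in_compose) (use has_derivative_subset[OF assms(5) sub] in simp)
  then show ?thesis
    using at_within_open[OF \<open>0 \<in> N\<close> \<open>open N\<close>] linear_cmul[OF has_derivative_linear[OF assms(5)]]
    by (simp add: has_vector_derivative_def)
qed

lemma has_derivative_within_subspace_unique:
  assumes "subspace A" "openin (top_of_set A) S" "u \<in> S" "a \<in> A"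
    "(f has_derivative E) (at u within S)" "(f has_derivative E') (at u within S)"
  shows "E a = E' a"
  using has_derivative_within_line[OF assms(1-5)] has_derivative_within_line[OF assms(1-4,6)]
  by (rule vector_derivative_unique_at)

lemma subspace_projection:
  fixes C :: "'a::euclidean_space set"
  assumes "subspace C"
  obtains P where "linear P" "range P \<subseteq> C" "\<And>c. c \<in> C \<Longrightarrow> P c = c"
proof -
  obtain P where "linear P" "range P \<subseteq> C" "\<forall>c\<in>id ` C. id (P c) = c"
    using real_vector.linear_exists_right_inverse_on[OF real_vector.linear_id assms] by blast
  then show thesis using that[of P] by simp
qed

text \<open>A linear projection \<open>P\<close> onto \<open>C\<close> does not change
  \<open>f\<close> on \<open>S\<close>, so \<open>P\<close> after \<open>E\<close> is a derivative
  as well; uniqueness along \<open>A\<close> gives \<open>E a = P (E a)\<close>.\<close>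

lemma has_derivative_in_subspace:
  fixes f :: "'a::euclidean_space \<Rightarrow> 'b::euclidean_space"
  assumes "subspace A" "openin (top_of_set A) S" "u \<in> S" "a \<in> A"
    "(f has_derivative E) (at u within S)" "subspace C" "f ` S \<subseteq> C"
  shows "E a \<in> C"
proof -
  obtain P where P: "linear P" "range P \<subseteq> C" "\<And>c. c \<in> C \<Longrightarrow> P c = c"
    using subspace_projection[OF assms(6)] by blast
  have "((\<lambda>x. P (f x)) has_derivative (\<lambda>h. P (E h))) (at u within S)"
    using bounded_linear.has_derivative[OF _ assms(5)] P(1) linear_conv_bounded_linear by blast
  then have "(f has_derivative (\<lambda>h. P (E h))) (at u within S)"
    by (rule has_derivative_transform[rotated 2]) (use assms P in auto)
  then have "E a = P (E a)"
    using has_derivative_within_subspace_unique[OF assms(1-5)] by blast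
  then show ?thesis using P(2) by (metis rangeI subsetD)
qed

text \<open>The smooth function \<open>H\<close> below restricts to \<open>\<phi>\<close> composed with a linear right inverse of its
  derivative on \<open>C\<close>, and is completed by a complementary projection so that it has
  derivative \<open>id\<close> and the inverse function theorem applies.\<close>

lemma submersion_local_section:
  fixes \<phi> :: "'a::euclidean_space \<Rightarrow> 'b::euclidean_space"
  assumes A: "subspace A" "openin (top_of_set A) S" and C: "subspace C"
    and \<phi>: "smooth_on S \<phi>" "\<phi> ` S \<subseteq> C" "u \<in> S"
      "(\<phi> has_derivative D) (at u within S)" "D ` A = C"
  obtains V s where "open V" "\<phi> u \<in> V" "smooth_on (C \<inter> V) s" "s ` (C \<inter> V) \<subseteq> S"
    "\<And>z. z \<in> C \<inter> V \<Longrightarrow> \<phi> (s z) = z" "s (\<phi> u) = u"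
proof -
  obtain W g where W: "open W" "u \<in> W" "\<And>k. Ck_on k W g" "\<And>y. y \<in> S \<inter> W \<Longrightarrow> g y = \<phi> y"
    using bspec[OF \<phi>(1)[unfolded smooth_on_def] \<phi>(3)] by auto
  obtain W0 where W0: "open W0" "S = A \<inter> W0" using A(2) by (auto simp: openin_open)
  define O' where "O' = W \<inter> W0"
  have O': "open O'" "S \<inter> W = A \<inter> O'" "u \<in> A" "u \<in> O'" using W0 W(1,2) \<phi>(3) by (auto simp: O'_def)
  define E where "E = frechet_derivative g (at u)"
  have dg: "(g has_derivative E) (at u)"
    unfolding E_def using Ck_on_has_derivative[OF W(3) W(2)] .
  have "(\<phi> has_derivative E) (at u within S)"
    by (rule has_derivative_transform_eventually[OF has_derivative_at_withinI[OF dg]])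
      (use W \<phi>(3) in \<open>auto simp: eventually_at_topological\<close>)
  \<comment> \<open>Off \<open>A\<close> the derivative of the ambient extension \<open>g\<close>
    may differ from \<open>D\<close>; only the image of \<open>A\<close> enters below.\<close>
  then have "E a = D a" if "a \<in> A" for a
    using has_derivative_within_subspace_unique[OF A \<phi>(3) that] \<phi>(4) by blast
  then have EA: "E ` A = C" using \<phi>(5) by force
  obtain T where T: "range T \<subseteq> A" "linear T" "\<And>c. c \<in> C \<Longrightarrow> E (T c) = c"
    using real_vector.linear_exists_right_inverse_on[OF has_derivative_linear[OF dg] A(1)] EA by auto
  obtain P where P: "linear P" "range P \<subseteq> C" "\<And>c. c \<in> C \<Longrightarrow> P c = c"
    using subspace_projection[OF C] by blast
  have bl: "bounded_linear T" "bounded_linear P" "bounded_linear (\<lambda>y. T (P y))"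
    using T(2) P(1) linear_compose[OF P(1) T(2)] by (auto simp: linear_conv_bounded_linear o_def)
  \<comment> \<open>\<open>P\<close> retracts onto \<open>C\<close>, where \<open>T\<close> is a
    right inverse of \<open>E\<close> with values in \<open>A\<close>. Hence \<open>L\<close> is
    affine with values in \<open>A\<close> and sends \<open>\<phi> u\<close> to \<open>u\<close>, so
    near \<open>\<phi> u\<close> the function \<open>g\<close> is evaluated only where it agrees
    with \<open>\<phi>\<close>.\<close>
  define L where "L y = u + T (P (y - \<phi> u))" for y
  define H where "H y = g (L y) + (y - P y)" for y
  have v: "\<phi> u \<in> C" using \<phi>(2,3) by blast
  have TP0: "T (P 0) = 0" by (simp add: linear_0[OF T(2)] linear_0[OF P(1)])
  have CkL: "Ck_on k B L" if "open B" for k B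
  proof -
    have "Ck_on k B (\<lambda>y. (u - T (P (\<phi> u))) + T (P y))"
      by (intro Ck_on_add that Ck_on_const Ck_on_bounded_linear bl)
    moreover have "(u - T (P (\<phi> u))) + T (P y) = L y" for y
      by (simp add: L_def linear_diff[OF T(2)] linear_diff[OF P(1)])
    ultimately show ?thesis by simp
  qed
  define U where "U = L -` O'"
  have U: "open U" unfolding U_def
    using O'(1) Ck_on_continuous[OF CkL[OF open_UNIV]] by (intro open_vimage) auto
  have vU: "\<phi> u \<in> U" using O'(4) TP0 by (simp add: U_def L_def)
  have "Ck_on k U (\<lambda>y. g (L y))" for k
    by (rule Ck_on_compose[OF U W(1) _ CkL[OF U] W(3)]) (auto simp: U_def O'_def)
  moreover have "Ck_on k U (\<lambda>y. y - P y)" for k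
    by (intro Ck_on_bounded_linear U bounded_linear_sub bl bounded_linear_ident)
  ultimately have CkH: "Ck_on k U H" for k unfolding H_def using Ck_on_add[OF U] by blast
  have dL: "(L has_derivative (\<lambda>h. T (P h))) (at (\<phi> u))"
  proof -
    have "((\<lambda>y. y - \<phi> u) has_derivative (\<lambda>h. h)) (at (\<phi> u))"
      by (auto intro!: derivative_eq_intros)
    then show ?thesis
      unfolding L_def using has_derivative_add[OF has_derivative_const bounded_linear.has_derivative[OF bl(3)]]
      by fastforce
  qed
  have Lv: "L (\<phi> u) = u" by (simp add: L_def TP0)
  have dH: "(H has_derivative (\<lambda>h. h)) (at (\<phi> u))"
  proof -
    have "((\<lambda>y. g (L y)) has_derivative (\<lambda>h. E (T (P h)))) (at (\<phi> u))"
      by (rule has_derivative_compose[OF dL]) (simp add: Lv dg)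
    then have "(H has_derivative (\<lambda>h. E (T (P h)) + (h - P h))) (at (\<phi> u))"
      unfolding H_def
      by (intro has_derivative_add has_derivative_diff has_derivative_ident
          bounded_linear_imp_has_derivative bl)
    moreover have "E (T (P h)) = P h" for h using T(3) P(2) by blast
    ultimately show ?thesis by simp
  qed
  have Hv: "H (\<phi> u) = \<phi> u" using W(4)[of u] W(2) \<phi>(3) Lv P(3)[OF v] by (simp add: H_def)
  obtain V K where K: "open V" "H (\<phi> u) \<in> V" "\<And>k. Ck_on k V K" "K ` V \<subseteq> U"
    "\<And>z. z \<in> V \<Longrightarrow> H (K z) = z" "K (H (\<phi> u)) = \<phi> u"
    using smooth_local_inverse[OF U vU CkH dH] by blast
  define s where "s z = L (K z)" for z
  have LA: "L y \<in> A" for y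
    unfolding L_def using T(1) A(1) O'(3) by (auto intro: subspace_add)
  have sS: "s z \<in> S \<inter> W" if "z \<in> V" for z
    using K(4) that LA O'(2) unfolding s_def U_def by blast
  have "\<phi> (s z) = z" if z: "z \<in> C \<inter> V" for z
  proof -
    \<comment> \<open>The correction \<open>?y - P ?y\<close> equals
      \<open>z - \<phi> (s z)\<close>, so it lies in \<open>C\<close> and is fixed by
      \<open>P\<close>. But \<open>P\<close> also annihilates it, so it is zero.\<close>
    let ?y = "K z"
    have zeq: "z = \<phi> (s z) + (?y - P ?y)"
      using K(5)[of z] z W(4)[OF sS, of z] by (simp add: H_def s_def)
    have "\<phi> (s z) \<in> C" using sS z \<phi>(2) by blast
    then have "z - \<phi> (s z) \<in> C" using z C by (auto intro: subspace_diff)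
    moreover have "z - \<phi> (s z) = ?y - P ?y" using zeq by (metis add_diff_cancel_left')
    ultimately have "P (?y - P ?y) = ?y - P ?y" using P(3) by simp
    moreover have "P (?y - P ?y) = 0" using P linear_diff[OF P(1)] by (simp add: image_subset_iff)
    ultimately show ?thesis using zeq by simp
  qed
  moreover have "smooth_on (C \<inter> V) s"
  proof (rule smooth_on_subset[OF smooth_on_Ck[OF K(1)]])
    show "Ck_on k V s" for k
      unfolding s_def using Ck_on_compose[OF K(1) open_UNIV _ K(3) CkL[OF open_UNIV]] by simp
  qed auto
  moreover have "s (\<phi> u) = u" unfolding s_def using K(6) Hv Lv by simp
  ultimately show thesis using that[of V s] K(1,2) Hv sS by auto
qed

section \<open>Maps between manifolds in charts\<close>

lemma is_chartD:
  assumes "is_chart X c"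
  shows "openin X (chart_dom c)" "subspace (chart_space c)" "inj_on (chart_map c) (chart_dom c)"
    "chart_dom c \<subseteq> topspace X" "chart_map c ` chart_dom c \<subseteq> chart_space c"
proof -
  show o: "openin X (chart_dom c)" and "subspace (chart_space c)"
    using assms unfolding is_chart_def by auto
  show d: "chart_dom c \<subseteq> topspace X" using o by (rule openin_subset)
  have "homeomorphic_map (subtopology X (chart_dom c))
      (top_of_set (chart_map c ` chart_dom c)) (chart_map c)"
    using assms unfolding is_chart_def by blast
  then show "inj_on (chart_map c) (chart_dom c)"
    using homeomorphic_imp_injective_map d by (fastforce simp: Int_absorb1)
  show "chart_map c ` chart_dom c \<subseteq> chart_space c"
    using assms unfolding is_chart_def by (metis openin_imp_subset)
qed

lemma is_chart_image_open:
  assumes "is_chart X c" "openin X N" "N \<subseteq> chart_dom c"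
  shows "openin (top_of_set (chart_space c)) (chart_map c ` N)"
proof -
  have h: "homeomorphic_map (subtopology X (chart_dom c))
      (top_of_set (chart_map c ` chart_dom c)) (chart_map c)"
    and o: "openin (top_of_set (chart_space c)) (chart_map c ` chart_dom c)"
    using assms(1) unfolding is_chart_def by auto
  have "openin (subtopology X (chart_dom c)) N"
    using assms is_chartD(1)[OF assms(1)] by (simp add: openin_open_subtopology)
  then have "openin (top_of_set (chart_map c ` chart_dom c)) (chart_map c ` N)"
    using homeomorphic_imp_open_map[OF h] unfolding open_map_def by blast
  then show ?thesis using o by (rule openin_trans)
qed

lemma local_dom_subset: "is_chart X c \<Longrightarrow> local_dom c d f \<subseteq> chart_space c"
  unfolding local_dom_def using is_chartD(5) by blast

lemma local_dom_open:
  assumes "is_chart X c" "openin Y (chart_dom d)" "continuous_map X Y f"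
  shows "openin (top_of_set (chart_space c)) (local_dom c d f)"
proof -
  have "openin X ({x \<in> topspace X. f x \<in> chart_dom d} \<inter> chart_dom c)"
    using openin_continuous_map_preimage[OF assms(3,2)] is_chartD(1)[OF assms(1)]
    by (rule openin_Int)
  moreover have "{x \<in> topspace X. f x \<in> chart_dom d} \<inter> chart_dom c
      = {x \<in> chart_dom c. f x \<in> chart_dom d}"
    using is_chartD(4)[OF assms(1)] by blast
  ultimately show ?thesis
    unfolding local_dom_def using is_chart_image_open[OF assms(1)] by auto
qed

lemma local_rep_apply:
  "inj_on (chart_map c) (chart_dom c) \<Longrightarrow> x \<in> chart_dom c \<Longrightarrow>
    local_rep c d f (chart_map c x) = chart_map d (f x)"
  by (simp add: local_rep_def)

lemma smooth_in_charts_cong: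
  assumes "inj_on (chart_map c) (chart_dom c)" "\<And>x. x \<in> chart_dom c \<Longrightarrow> f x = g x"
    "smooth_in_charts c d f"
  shows "smooth_in_charts c d g"
proof -
  have "local_dom c d g = local_dom c d f" unfolding local_dom_def using assms(2) by auto
  moreover have "smooth_on (local_dom c d f) (local_rep c d g)"
    using assms(3) unfolding smooth_in_charts_def
    by (rule smooth_on_cong) (use assms(1,2) in \<open>auto simp: local_dom_def local_rep_apply\<close>)
  ultimately show ?thesis unfolding smooth_in_charts_def by simp
qed

text \<open>Smoothness is local, so the intermediate chart \<open>d\<close> may depend on the point:
  near that point the expression of the composite factors through \<open>d\<close>.\<close>

lemma smooth_in_charts_compose:
  fixes X :: "'a topology" and Y :: "'b topology"
  assumes c: "is_chart X c" and f: "continuous_map X Y f"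
    and ex: "\<And>x. x \<in> chart_dom c \<Longrightarrow> g (f x) \<in> chart_dom e \<Longrightarrow>
      \<exists>d::('b, 'f::euclidean_space) chart. openin Y (chart_dom d) \<and> inj_on (chart_map d) (chart_dom d) \<and> f x \<in> chart_dom d \<and>
        smooth_in_charts c d f \<and> smooth_in_charts d e g"
  shows "smooth_in_charts c e (\<lambda>x. g (f x))"
  unfolding smooth_in_charts_def
proof (rule smooth_on_locally)
  note inj = is_chartD(3)[OF c]
  fix u assume "u \<in> local_dom c e (\<lambda>x. g (f x))"
  then obtain x where x: "u = chart_map c x" "x \<in> chart_dom c" "g (f x) \<in> chart_dom e"
    unfolding local_dom_def by blast
  then obtain d :: "('b, 'f) chart" where d: "openin Y (chart_dom d)" "inj_on (chart_map d) (chart_dom d)"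
      "f x \<in> chart_dom d" "smooth_in_charts c d f" "smooth_in_charts d e g"
    using ex by blast
  \<comment> \<open>\<open>local_dom c d f\<close> is relatively open, so \<open>W\<close> cuts out
    the coordinates of points that \<open>f\<close> sends into the domain of
    \<open>d\<close>.\<close>
  obtain W where W: "open W" "local_dom c d f = chart_space c \<inter> W"
    using local_dom_open[OF c d(1) f] by (auto simp: openin_open)
  have "u \<in> local_dom c d f" using x d(3) unfolding local_dom_def by blast
  then have uW: "u \<in> W" using W by blast
  let ?S = "local_dom c e (\<lambda>x. g (f x)) \<inter> W"
  have S: "\<exists>y. z = chart_map c y \<and> y \<in> chart_dom c \<and> f y \<in> chart_dom d \<and> g (f y) \<in> chart_dom e"
    if z: "z \<in> ?S" for z
  proof -
    obtain y where y: "z = chart_map c y" "y \<in> chart_dom c" "g (f y) \<in> chart_dom e"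
      using z unfolding local_dom_def by blast
    have "z \<in> local_dom c d f" using z W local_dom_subset[OF c] by blast
    then obtain y' where y': "z = chart_map c y'" "y' \<in> chart_dom c" "f y' \<in> chart_dom d"
      unfolding local_dom_def by blast
    have "y' = y" using inj y y' by (metis inj_onD)
    then show ?thesis using y y' by blast
  qed
  have "smooth_on ?S (\<lambda>z. local_rep d e g (local_rep c d f z))"
  proof (rule smooth_on_compose[where f = "local_rep c d f" and g = "local_rep d e g"
        and T = "local_dom d e g"])
    show "smooth_on ?S (local_rep c d f)"
      by (rule smooth_on_subset[OF d(4)[unfolded smooth_in_charts_def]])
        (use W local_dom_subset[OF c] in blast)
    show "smooth_on (local_dom d e g) (local_rep d e g)"
      using d(5) unfolding smooth_in_charts_def .
    show "local_rep c d f ` ?S \<subseteq> local_dom d e g"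
    proof
      fix w assume "w \<in> local_rep c d f ` ?S"
      then obtain z where z: "z \<in> ?S" "w = local_rep c d f z" by blast
      obtain y where "z = chart_map c y" "y \<in> chart_dom c" "f y \<in> chart_dom d" "g (f y) \<in> chart_dom e"
        using S[OF z(1)] by blast
      then show "w \<in> local_dom d e g"
        unfolding z(2) local_dom_def by (auto simp: local_rep_apply[OF inj])
    qed
  qed
  then have "smooth_on ?S (local_rep c e (\<lambda>x. g (f x)))"
  proof (rule smooth_on_cong)
    fix z assume "z \<in> ?S"
    then obtain y where "z = chart_map c y" "y \<in> chart_dom c" "f y \<in> chart_dom d"
      using S by blast
    then show "local_rep d e g (local_rep c d f z) = local_rep c e (\<lambda>x. g (f x)) z"
      by (simp add: local_rep_apply[OF inj] local_rep_apply[OF d(2)])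
  qed
  then show "\<exists>W. open W \<and> u \<in> W \<and> smooth_on (local_dom c e (\<lambda>x. g (f x)) \<inter> W) (local_rep c e (\<lambda>x. g (f x)))"
    using W(1) uW by blast
qed

lemma smooth_manifoldD:
  assumes "smooth_manifold M"
  shows "c \<in> mfd_atlas M \<Longrightarrow> is_chart (mfd_top M) c"
    "x \<in> points M \<Longrightarrow> \<exists>c\<in>mfd_atlas M. x \<in> chart_dom c"
    "c \<in> mfd_atlas M \<Longrightarrow> d \<in> mfd_atlas M \<Longrightarrow> smooth_in_charts c d (\<lambda>x. x)"
proof -
  show "c \<in> mfd_atlas M \<Longrightarrow> is_chart (mfd_top M) c"
    "c \<in> mfd_atlas M \<Longrightarrow> d \<in> mfd_atlas M \<Longrightarrow> smooth_in_charts c d (\<lambda>x. x)"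
    using assms unfolding smooth_manifold_def by auto
  have "(\<Union>c\<in>mfd_atlas M. chart_dom c) = points M"
    using assms unfolding smooth_manifold_def by blast
  then show "x \<in> points M \<Longrightarrow> \<exists>c\<in>mfd_atlas M. x \<in> chart_dom c" by blast
qed

lemma smooth_map_cong:
  assumes "\<And>c. c \<in> mfd_atlas M \<Longrightarrow> is_chart (mfd_top M) c"
    "\<And>x. x \<in> points M \<Longrightarrow> f x = g x" "smooth_map M N f"
  shows "smooth_map M N g"
  unfolding smooth_map_def
proof (intro conjI ballI)
  show "continuous_map (mfd_top M) (mfd_top N) g"
    using assms(2,3) continuous_map_eq unfolding smooth_map_def by blast
  show "smooth_in_charts c d g" if c: "c \<in> mfd_atlas M" and "d \<in> mfd_atlas N" for c d
    by (rule smooth_in_charts_cong[of c f])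
      (use assms that is_chartD(3,4)[OF assms(1)[OF c]] in \<open>auto simp: smooth_map_def\<close>)
qed

lemma smooth_map_compose:
  fixes N :: "('b, 'f::euclidean_space) mfd"
  assumes M: "\<And>c. c \<in> mfd_atlas M \<Longrightarrow> is_chart (mfd_top M) c" and N: "smooth_manifold N"
    and f: "smooth_map M N f" and g: "smooth_map N P g"
  shows "smooth_map M P (\<lambda>x. g (f x))"
  unfolding smooth_map_def
proof (intro conjI ballI)
  have cf: "continuous_map (mfd_top M) (mfd_top N) f"
    using f unfolding smooth_map_def by blast
  show "continuous_map (mfd_top M) (mfd_top P) (\<lambda>x. g (f x))"
    using continuous_map_compose[OF cf] g unfolding smooth_map_def o_def by blast
  fix c e assume c: "c \<in> mfd_atlas M" and e: "e \<in> mfd_atlas P"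
  show "smooth_in_charts c e (\<lambda>x. g (f x))"
  proof (rule smooth_in_charts_compose[OF M[OF c] cf])
    fix x assume "x \<in> chart_dom c"
    then have "x \<in> points M" using is_chartD(4)[OF M[OF c]] by blast
    then have "f x \<in> points N" using cf by (auto simp: continuous_map_def)
    then obtain d where "d \<in> mfd_atlas N" "f x \<in> chart_dom d" using smooth_manifoldD(2)[OF N] by blast
    then show "\<exists>d::('b, 'f) chart. openin (mfd_top N) (chart_dom d) \<and> inj_on (chart_map d) (chart_dom d) \<and>
        f x \<in> chart_dom d \<and> smooth_in_charts c d f \<and> smooth_in_charts d e g"
      using is_chartD(1,3)[OF smooth_manifoldD(1)[OF N]] f g c e unfolding smooth_map_def by blast
  qed
qed

lemma smooth_funs_cong:
  assumes "smooth_manifold M" "\<And>x. x \<in> points M \<Longrightarrow> f x = g x"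
  shows "f \<in> smooth_funs M \<longleftrightarrow> g \<in> smooth_funs M"
  unfolding smooth_funs_def
  using smooth_map_cong[of M f g] smooth_map_cong[of M g f] smooth_manifoldD(1)[OF assms(1)] assms(2)
  by auto

text \<open>In charts, \<open>R\<close> and its inverse \<open>R'\<close> have derivatives
  \<open>E\<close> and \<open>E'\<close> with \<open>E (E' w) = w\<close> on the model space
  \<open>B\<close>. So \<open>E\<close> maps one model space onto the other, and the chain rule
  passes the surjectivity of the derivative of \<open>q\<close> on to the composite.\<close>

lemma submersive_in_charts_diffeomorphism:
  fixes M :: "('a, 'e::euclidean_space) mfd"
  assumes M: "smooth_manifold M"
    and R: "smooth_map M M R" and R': "smooth_map M M R'"
    and inv: "\<And>x. x \<in> points M \<Longrightarrow> R (R' x) = x" "\<And>x. x \<in> points M \<Longrightarrow> R' (R x) = x"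
    and q: "continuous_map (mfd_top M) Y q" and d: "openin Y (chart_dom d)"
    and sub: "\<And>c. c \<in> mfd_atlas M \<Longrightarrow> submersive_in_charts c d q"
    and c: "c \<in> mfd_atlas M"
  shows "submersive_in_charts c d (\<lambda>x. q (R x))"
  unfolding submersive_in_charts_def
proof (intro conjI ballI)
  note ch = smooth_manifoldD(1)[OF M]
  note inj = is_chartD(3)[OF ch]
  have cR: "continuous_map (mfd_top M) (mfd_top M) R" and cR': "continuous_map (mfd_top M) (mfd_top M) R'"
    using R R' unfolding smooth_map_def by auto
  have pts: "x \<in> points M" if "x \<in> chart_dom a" "a \<in> mfd_atlas M" for x a
    using that is_chartD(4)[OF ch] by blast
  have Rpts: "R x \<in> points M" "R' x \<in> points M" if "x \<in> points M" for x
    using cR cR' that by (auto simp: continuous_map_def)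
  have cqR: "continuous_map (mfd_top M) Y (\<lambda>x. q (R x))"
    using continuous_map_compose[OF cR q] by (simp add: o_def)
  show "smooth_in_charts c d (\<lambda>x. q (R x))"
  proof (rule smooth_in_charts_compose[OF ch[OF c] cR])
    fix x assume "x \<in> chart_dom c"
    then obtain b where "b \<in> mfd_atlas M" "R x \<in> chart_dom b"
      using smooth_manifoldD(2)[OF M] Rpts pts[OF _ c] by blast
    then show "\<exists>b::('a, 'e) chart. openin (mfd_top M) (chart_dom b) \<and> inj_on (chart_map b) (chart_dom b) \<and>
        R x \<in> chart_dom b \<and> smooth_in_charts c b R \<and> smooth_in_charts b d q"
      using is_chartD(1)[OF ch] inj R c sub unfolding smooth_map_def submersive_in_charts_def by blast
  qed
  fix u assume u: "u \<in> local_dom c d (\<lambda>x. q (R x))"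
  let ?L = "local_dom c d (\<lambda>x. q (R x))"
  obtain x where x: "u = chart_map c x" "x \<in> chart_dom c" "q (R x) \<in> chart_dom d"
    using u unfolding local_dom_def by blast
  obtain b where b: "b \<in> mfd_atlas M" "R x \<in> chart_dom b"
    using smooth_manifoldD(2)[OF M] Rpts pts[OF x(2) c] by blast
  define A where "A = chart_space c"
  define B where "B = chart_space b"
  have AB: "subspace A" "subspace B" using is_chartD(2)[OF ch] c b by (auto simp: A_def B_def)
  define \<rho> where "\<rho> = local_rep c b R"
  define \<rho>' where "\<rho>' = local_rep b c R'"
  define T where "T = local_dom c b R"
  define T' where "T' = local_dom b c R'"
  have T: "openin (top_of_set A) T" and T': "openin (top_of_set B) T'"
    unfolding T_def T'_def A_def B_def
    using local_dom_open[OF ch is_chartD(1)[OF ch]] c b(1) cR cR' by blast+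
  have uT: "u \<in> T" using x b unfolding T_def local_dom_def by blast
  have \<rho>u: "\<rho> u = chart_map b (R x)" by (simp add: \<rho>_def x(1) local_rep_apply[OF inj[OF c] x(2)])
  have R'R: "R' (R x) = x" using inv(2) pts[OF x(2) c] by blast
  have \<rho>uT': "\<rho> u \<in> T'" using \<rho>u b x R'R unfolding T'_def local_dom_def by auto
  have \<rho>'\<rho>u: "\<rho>' (\<rho> u) = u"
    unfolding \<rho>u \<rho>'_def by (simp add: local_rep_apply[OF inj[OF b(1)] b(2)] R'R x(1))
  have sR: "smooth_on T \<rho>" and sR': "smooth_on T' \<rho>'"
    using R R' c b unfolding smooth_map_def smooth_in_charts_def T_def T'_def \<rho>_def \<rho>'_def by auto
  obtain E where E: "(\<rho> has_derivative E) (at u within T)"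
    using smooth_on_has_derivative[OF sR uT] .
  obtain E' where E': "(\<rho>' has_derivative E') (at (\<rho> u) within T')"
    using smooth_on_has_derivative[OF sR' \<rho>uT'] .
  have imT: "\<rho> ` T \<subseteq> B"
    unfolding T_def \<rho>_def B_def local_dom_def
    using is_chartD(5)[OF ch[OF b(1)]] by (auto simp: local_rep_apply[OF inj[OF c]])
  have imT': "\<rho>' ` T' \<subseteq> A"
    unfolding T'_def \<rho>'_def A_def local_dom_def
    using is_chartD(5)[OF ch[OF c]] by (auto simp: local_rep_apply[OF inj[OF b(1)]])
  have T'elem: "\<exists>y. w = chart_map b y \<and> y \<in> chart_dom b \<and> R' y \<in> chart_dom c \<and> R (R' y) = y"
    if "w \<in> T'" for w
    using that inv(1) pts[OF _ b(1)] unfolding T'_def local_dom_def by blast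
  have EE': "E (E' w) = w" if w: "w \<in> B" for w
  proof -
    have sub: "\<rho>' ` T' \<subseteq> T"
    proof
      fix z assume "z \<in> \<rho>' ` T'"
      then obtain y where "z = \<rho>' (chart_map b y)" "y \<in> chart_dom b" "R' y \<in> chart_dom c" "R (R' y) = y"
        using T'elem by blast
      then show "z \<in> T"
        unfolding T_def local_dom_def \<rho>'_def by (auto simp: local_rep_apply[OF inj[OF b(1)]])
    qed
    have "((\<lambda>w. \<rho> (\<rho>' w)) has_derivative (\<lambda>h. E (E' h))) (at (\<rho> u) within T')"
      by (rule has_derivative_in_compose[OF E'])
        (use has_derivative_subset[OF E sub] \<rho>'\<rho>u in simp)
    then have "((\<lambda>w. w) has_derivative (\<lambda>h. E (E' h))) (at (\<rho> u) within T')"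
    proof (rule has_derivative_transform[rotated 2])
      fix w assume "w \<in> T'"
      then obtain y where "w = chart_map b y" "y \<in> chart_dom b" "R' y \<in> chart_dom c" "R (R' y) = y"
        using T'elem by blast
      then show "w = \<rho> (\<rho>' w)"
        unfolding \<rho>_def \<rho>'_def by (simp add: local_rep_apply[OF inj[OF b(1)]] local_rep_apply[OF inj[OF c]])
    qed fact
    then show ?thesis
      using has_derivative_within_subspace_unique[OF AB(2) T' \<rho>uT' w _ has_derivative_ident] by blast
  qed
  have EA: "E ` A = B"
  proof
    show "E ` A \<subseteq> B" using has_derivative_in_subspace[OF AB(1) T uT _ E AB(2) imT] by blast
    show "B \<subseteq> E ` A"
      using EE' has_derivative_in_subspace[OF AB(2) T' \<rho>uT' _ E' AB(1) imT'] by (metis imageI subsetI)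
  qed
  have \<rho>uq: "\<rho> u \<in> local_dom b d q" using \<rho>u b x(3) unfolding local_dom_def by auto
  then obtain D where D: "(local_rep b d q has_derivative D) (at (\<rho> u) within local_dom b d q)"
      "D ` B = chart_space d"
    using sub[OF b(1)] unfolding submersive_in_charts_def B_def by blast
  let ?S = "T \<inter> ?L"
  have Selem: "\<exists>y. z = chart_map c y \<and> y \<in> chart_dom c \<and> R y \<in> chart_dom b \<and> q (R y) \<in> chart_dom d"
    if "z \<in> ?S" for z
    using that inj_onD[OF inj[OF c]] unfolding T_def local_dom_def by blast
  have "\<rho> ` ?S \<subseteq> local_dom b d q"
  proof
    fix w assume "w \<in> \<rho> ` ?S"
    then obtain y where "w = \<rho> (chart_map c y)" "y \<in> chart_dom c" "R y \<in> chart_dom b"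
        "q (R y) \<in> chart_dom d"
      using Selem by blast
    then show "w \<in> local_dom b d q"
      unfolding local_dom_def \<rho>_def by (auto simp: local_rep_apply[OF inj[OF c]])
  qed
  then have "((\<lambda>z. local_rep b d q (\<rho> z)) has_derivative (\<lambda>h. D (E h))) (at u within ?S)"
    using has_derivative_in_compose[OF has_derivative_subset[OF E, of ?S]]
      has_derivative_subset[OF D(1)] by blast
  then have "(local_rep c d (\<lambda>x. q (R x)) has_derivative (\<lambda>h. D (E h))) (at u within ?S)"
  proof (rule has_derivative_transform[rotated 2])
    show "u \<in> ?S" using uT u by blast
    fix z assume "z \<in> ?S"
    then obtain y where "z = chart_map c y" "y \<in> chart_dom c" "R y \<in> chart_dom b"
      using Selem by blast
    then show "local_rep c d (\<lambda>x. q (R x)) z = local_rep b d q (\<rho> z)"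
      unfolding \<rho>_def by (simp add: local_rep_apply[OF inj[OF b(1)]] local_rep_apply[OF inj[OF c]])
  qed
  \<comment> \<open>The chain rule was available only on \<open>?S\<close>, where the translated
    points stay in the chart \<open>b\<close>. Since \<open>T\<close> is relatively open and
    contains \<open>u\<close>, enlarging \<open>?S\<close> to \<open>?L\<close> leaves the filter
    unchanged.\<close>
  moreover have "at u within ?S = at u within ?L"
  proof -
    obtain W where W: "open W" "T = A \<inter> W" using T by (auto simp: openin_open)
    have "?L \<subseteq> A" unfolding A_def by (rule local_dom_subset[OF ch[OF c]])
    then show ?thesis using at_within_nhd[of u W ?S ?L] W uT by blast
  qed
  ultimately have "(local_rep c d (\<lambda>x. q (R x)) has_derivative (\<lambda>h. D (E h))) (at u within ?L)"
    by simp
  moreover have "(\<lambda>h. D (E h)) ` chart_space c = chart_space d"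
    using EA D(2) unfolding A_def by (metis image_image)
  ultimately show "\<exists>D. (local_rep c d (\<lambda>x. q (R x)) has_derivative D) (at u within ?L) \<and>
      D ` chart_space c = chart_space d"
    by blast
qed

text \<open>Right translation is multiplication with the second factor frozen at \<open>a\<close>;
  in product charts this inserts the constant \<open>chart_map b a\<close> as second coordinate, a
  smooth map.\<close>

lemma lie_group_right_translation_smooth:
  assumes lie: "lie_group G M" and a: "a \<in> carrier G"
  shows "smooth_map M M (\<lambda>x. x \<otimes>\<^bsub>G\<^esub> a)"
proof -
  have M: "smooth_manifold M" and pts: "points M = carrier G"
    and mult: "smooth_map (product_mfd M M) M (\<lambda>(x, y). x \<otimes>\<^bsub>G\<^esub> y)"
    using lie unfolding lie_group_def by auto
  have "continuous_map (mfd_top M) (prod_topology (mfd_top M) (mfd_top M)) (\<lambda>x. (x, a))"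
    using a pts by (simp add: continuous_map_pairwise o_def)
  moreover have "continuous_map (prod_topology (mfd_top M) (mfd_top M)) (mfd_top M) (\<lambda>(x, y). x \<otimes>\<^bsub>G\<^esub> y)"
    using mult unfolding smooth_map_def product_mfd_def by simp
  ultimately have "continuous_map (mfd_top M) (mfd_top M) (\<lambda>x. x \<otimes>\<^bsub>G\<^esub> a)"
    using continuous_map_compose by (fastforce simp: o_def)
  moreover have "smooth_in_charts c e (\<lambda>x. x \<otimes>\<^bsub>G\<^esub> a)" if c: "c \<in> mfd_atlas M" and e: "e \<in> mfd_atlas M" for c e
  proof -
    obtain b where b: "b \<in> mfd_atlas M" "a \<in> chart_dom b"
      using smooth_manifoldD(2)[OF M] a pts by blast
    note injc = is_chartD(3)[OF smooth_manifoldD(1)[OF M c]]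
    note injb = is_chartD(3)[OF smooth_manifoldD(1)[OF M b(1)]]
    let ?cb = "\<lparr>chart_dom = chart_dom c \<times> chart_dom b,
      chart_map = map_prod (chart_map c) (chart_map b), chart_space = chart_space c \<times> chart_space b\<rparr>"
    let ?m = "\<lambda>(x, y). x \<otimes>\<^bsub>G\<^esub> y"
    have injcb: "inj_on (chart_map ?cb) (chart_dom ?cb)"
      using injc injb by (auto intro: map_prod_inj_on)
    have "?cb \<in> mfd_atlas (product_mfd M M)" using c b unfolding product_mfd_def by auto
    then have "smooth_on (local_dom ?cb e ?m) (local_rep ?cb e ?m)"
      using mult e unfolding smooth_map_def smooth_in_charts_def by blast
    moreover have "(\<lambda>u. (u, chart_map b a)) ` local_dom c e (\<lambda>x. x \<otimes>\<^bsub>G\<^esub> a) \<subseteq> local_dom ?cb e ?m"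
      unfolding local_dom_def using b(2) by force
    ultimately have "smooth_on (local_dom c e (\<lambda>x. x \<otimes>\<^bsub>G\<^esub> a))
        (\<lambda>u. local_rep ?cb e ?m (u, chart_map b a))"
      by (intro smooth_on_compose[OF smooth_on_Pair_const])
    then show ?thesis
      unfolding smooth_in_charts_def
    proof (rule smooth_on_cong)
      fix u assume "u \<in> local_dom c e (\<lambda>x. x \<otimes>\<^bsub>G\<^esub> a)"
      then obtain x where x: "u = chart_map c x" "x \<in> chart_dom c" unfolding local_dom_def by blast
      have "local_rep ?cb e ?m (chart_map ?cb (x, a)) = chart_map e (?m (x, a))"
        by (rule local_rep_apply[OF injcb]) (use x b in simp)
      then show "local_rep ?cb e ?m (u, chart_map b a) = local_rep c e (\<lambda>x. x \<otimes>\<^bsub>G\<^esub> a) u"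
        using x(1) by (simp add: local_rep_apply[OF injc x(2)])
    qed
  qed
  ultimately show ?thesis unfolding smooth_map_def by blast
qed

section \<open>Homogeneous spaces\<close>

lemma (in group) mult_inv_cancel_left:
  assumes "x \<in> carrier G" "y \<in> carrier G"
  shows "x \<otimes> (inv x \<otimes> y) = y" "inv x \<otimes> (x \<otimes> y) = y"
  using assms by (simp_all add: m_assoc[symmetric])

lemma coset_proj_iff: "y \<in> coset_proj G H x \<longleftrightarrow> (\<exists>h\<in>H. y = x \<otimes>\<^bsub>G\<^esub> h)"
  by (auto simp: coset_proj_def l_coset_def)

lemma coset_proj_eqD:
  assumes "group G" "subgroup H G" "y \<in> carrier G" "coset_proj G H x = coset_proj G H y"
  obtains h where "h \<in> H" "y = x \<otimes>\<^bsub>G\<^esub> h"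
proof -
  interpret group G by fact
  have "y \<in> coset_proj G H y"
    using coset_proj_iff[of y G H y] subgroup.one_closed[OF assms(2)] assms(3)
    by (auto intro!: bexI[of _ "\<one>\<^bsub>G\<^esub>"])
  then show thesis using that coset_proj_iff[of y G H x] assms(4) by auto
qed

lemma coset_proj_mult:
  assumes "group G" "subgroup H G" "x \<in> carrier G" "h \<in> H"
  shows "coset_proj G H (x \<otimes>\<^bsub>G\<^esub> h) = coset_proj G H x"
proof -
  interpret group G by fact
  interpret H: subgroup H G by fact
  have h: "h \<in> carrier G" using assms(4) by simp
  have "\<exists>k\<in>H. x \<otimes>\<^bsub>G\<^esub> h \<otimes>\<^bsub>G\<^esub> l = x \<otimes>\<^bsub>G\<^esub> k" if "l \<in> H" for l
    using that assms(3,4) by (intro bexI[of _ "h \<otimes>\<^bsub>G\<^esub> l"]) (auto simp: m_assoc)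
  moreover have "\<exists>k\<in>H. x \<otimes>\<^bsub>G\<^esub> l = x \<otimes>\<^bsub>G\<^esub> h \<otimes>\<^bsub>G\<^esub> k" if "l \<in> H" for l
    using that assms(3,4)
    by (intro bexI[of _ "inv\<^bsub>G\<^esub> h \<otimes>\<^bsub>G\<^esub> l"]) (auto simp: m_assoc mult_inv_cancel_left)
  ultimately have "y \<in> coset_proj G H (x \<otimes>\<^bsub>G\<^esub> h) \<longleftrightarrow> y \<in> coset_proj G H x" for y
    unfolding coset_proj_iff
    by metis
  then show ?thesis by blast
qed

lemma lcosets_coset_proj: "lcosets\<^bsub>G\<^esub> H = coset_proj G H ` carrier G"
  by (auto simp: LCOSETS_def coset_proj_def)

lemma lcosets_obtain:
  assumes "C \<in> lcosets\<^bsub>G\<^esub> H"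
  obtains x where "x \<in> carrier G" "C = coset_proj G H x"
  using assms unfolding lcosets_coset_proj by blast

lemma topspace_coset_topology:
  assumes "group G" "subgroup H G" "topspace X = carrier G"
  shows "topspace (coset_topology G H X) = lcosets\<^bsub>G\<^esub> H"
proof
  show "topspace (coset_topology G H X) \<subseteq> lcosets\<^bsub>G\<^esub> H"
    using openin_coset_topology[OF assms(1,2), of X "topspace (coset_topology G H X)"] by simp
  have "openin X (\<Union>(lcosets\<^bsub>G\<^esub> H))"
    using group.lcosets_part_G[OF assms(1,2)] assms(3) by (metis openin_topspace)
  then have "openin (coset_topology G H X) (lcosets\<^bsub>G\<^esub> H)"
    using openin_coset_topology[OF assms(1,2)] by blast
  then show "lcosets\<^bsub>G\<^esub> H \<subseteq> topspace (coset_topology G H X)" by (rule openin_subset)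
qed

text \<open>Turns \<open>coset_topology\<close> into the familiar quotient topology, in which a set
  is open when its preimage under the projection is.\<close>

lemma Union_cosets:
  assumes "group G" "subgroup H G" "U \<subseteq> lcosets\<^bsub>G\<^esub> H"
  shows "\<Union>U = {x \<in> carrier G. coset_proj G H x \<in> U}"
proof -
  interpret group G by fact
  interpret H: subgroup H G by fact
  have "x \<in> carrier G \<and> coset_proj G H x \<in> U" if x: "x \<in> A" and A: "A \<in> U" for x A
  proof -
    obtain g where g: "g \<in> carrier G" "A = coset_proj G H g"
      using lcosets_obtain[OF subsetD[OF assms(3) A]] .
    then obtain h where "h \<in> H" "x = g \<otimes>\<^bsub>G\<^esub> h"
      using x coset_proj_iff[of x G H g] by blast
    then show ?thesis using g A coset_proj_mult[OF assms(1,2) g(1)] by auto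
  qed
  moreover have "x \<in> coset_proj G H x" if "x \<in> carrier G" for x
    using that coset_proj_iff[of x G H x] H.one_closed by force
  ultimately show ?thesis by blast
qed

lemma coset_proj_continuous:
  assumes "group G" "subgroup H G" "topspace X = carrier G"
  shows "continuous_map X (coset_topology G H X) (coset_proj G H)"
proof -
  have "openin X {x \<in> carrier G. coset_proj G H x \<in> U}" if "openin (coset_topology G H X) U" for U
    using that Union_cosets[OF assms(1,2)] unfolding openin_coset_topology[OF assms(1,2)] by metis
  then show ?thesis
    unfolding continuous_map_def topspace_coset_topology[OF assms] assms(3)
    by (auto simp: lcosets_coset_proj)
qed

lemma homogeneous_space_simps:
  "mfd_top (homogeneous_space G H M) = coset_topology G H (mfd_top M)"
  "d \<in> mfd_atlas (homogeneous_space G H M) \<longleftrightarrow> is_chart (coset_topology G H (mfd_top M)) d \<and>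
    (\<forall>c\<in>mfd_atlas M. submersive_in_charts c d (coset_proj G H))"
  by (simp_all add: homogeneous_space_def)

text \<open>Local sections of the submersion \<open>coset_proj G H\<close> express a coordinate change
  between charts of the quotient through a chart of \<open>G\<close>.\<close>

lemma homogeneous_space_charts_compatible:
  fixes M :: "('g, 'e::euclidean_space) mfd"
  assumes G: "group G" "subgroup H G" and M: "smooth_manifold M" "points M = carrier G"
    and c: "c \<in> mfd_atlas (homogeneous_space G H M)"
    and d: "d \<in> mfd_atlas (homogeneous_space G H M)"
  shows "smooth_in_charts c d (\<lambda>x. x)"
  unfolding smooth_in_charts_def
proof (rule smooth_on_locally)
  let ?p = "coset_proj G H"
  let ?Y = "coset_topology G H (mfd_top M)"
  have chc: "is_chart ?Y c" and chd: "is_chart ?Y d"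
    and subc: "\<And>a. a \<in> mfd_atlas M \<Longrightarrow> submersive_in_charts a c ?p"
    and subd: "\<And>a. a \<in> mfd_atlas M \<Longrightarrow> submersive_in_charts a d ?p"
    using c d unfolding homogeneous_space_simps by auto
  note injc = is_chartD(3)[OF chc]
  fix z assume "z \<in> local_dom c d (\<lambda>x. x)"
  then obtain B where B: "z = chart_map c B" "B \<in> chart_dom c" "B \<in> chart_dom d"
    unfolding local_dom_def by blast
  then have "B \<in> lcosets\<^bsub>G\<^esub> H"
    using is_chartD(4)[OF chc] topspace_coset_topology[OF G M(2)] by blast
  then obtain g where g: "g \<in> carrier G" "B = ?p g" by (rule lcosets_obtain)
  obtain a where a: "a \<in> mfd_atlas M" "g \<in> chart_dom a"
    using smooth_manifoldD(2)[OF M(1)] g M(2) by blast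
  note cha = smooth_manifoldD(1)[OF M(1) a(1)]
  note inja = is_chartD(3)[OF cha]
  have p: "continuous_map (mfd_top M) ?Y ?p" by (rule coset_proj_continuous[OF G M(2)])
  define S where "S = local_dom a c ?p \<inter> local_dom a d ?p"
  have "openin (top_of_set (chart_space a)) S" unfolding S_def
    by (intro openin_Int local_dom_open[OF cha _ p] is_chartD(1)[OF chc] is_chartD(1)[OF chd])
  have Selem: "\<exists>x. y = chart_map a x \<and> x \<in> chart_dom a \<and> ?p x \<in> chart_dom c \<and> ?p x \<in> chart_dom d"
    if "y \<in> S" for y
    using that inj_onD[OF inja] unfolding S_def local_dom_def by blast
  let ?\<phi> = "local_rep a c ?p"
  let ?u = "chart_map a g"
  have uS: "?u \<in> S" unfolding S_def local_dom_def using a g B by auto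
  have "smooth_on S ?\<phi>"
    by (rule smooth_on_subset[where S = "local_dom a c ?p"])
      (use subc[OF a(1)] in \<open>auto simp: submersive_in_charts_def smooth_in_charts_def S_def\<close>)
  have sd: "smooth_on S (local_rep a d ?p)"
    by (rule smooth_on_subset[where S = "local_dom a d ?p"])
      (use subd[OF a(1)] in \<open>auto simp: submersive_in_charts_def smooth_in_charts_def S_def\<close>)
  have "?\<phi> ` S \<subseteq> chart_space c"
  proof
    fix w assume "w \<in> ?\<phi> ` S"
    then obtain y where "y \<in> S" "w = ?\<phi> y" by blast
    then obtain x where "w = ?\<phi> (chart_map a x)" "x \<in> chart_dom a" "?p x \<in> chart_dom c"
      using Selem by blast
    then show "w \<in> chart_space c"
      using is_chartD(5)[OF chc] by (auto simp: local_rep_apply[OF inja])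
  qed
  obtain D where D: "(?\<phi> has_derivative D) (at ?u within local_dom a c ?p)"
      "D ` chart_space a = chart_space c"
    using subc[OF a(1)] uS unfolding submersive_in_charts_def S_def by blast
  have DS: "(?\<phi> has_derivative D) (at ?u within S)"
    by (rule has_derivative_subset[OF D(1)]) (simp add: S_def)
  obtain V s where V: "open V" "?\<phi> ?u \<in> V" "smooth_on (chart_space c \<inter> V) s"
      "s ` (chart_space c \<inter> V) \<subseteq> S" "\<And>w. w \<in> chart_space c \<inter> V \<Longrightarrow> ?\<phi> (s w) = w" "s (?\<phi> ?u) = ?u"
    by (rule submersion_local_section[OF is_chartD(2)[OF cha] \<open>openin (top_of_set (chart_space a)) S\<close>
          is_chartD(2)[OF chc] \<open>smooth_on S ?\<phi>\<close> \<open>?\<phi> ` S \<subseteq> chart_space c\<close> uS DS D(2)]) (rule that)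
  have zu: "z = ?\<phi> ?u" using B(1) g(2) by (simp add: local_rep_apply[OF inja a(2)])
  let ?L = "local_dom c d (\<lambda>x. x)"
  have L: "?L \<subseteq> chart_space c" by (rule local_dom_subset[OF chc])
  have "smooth_on (?L \<inter> V) (\<lambda>w. local_rep a d ?p (s w))"
    by (rule smooth_on_compose[OF smooth_on_subset[OF V(3)] sd]) (use L V(4) in auto)
  then have "smooth_on (?L \<inter> V) (local_rep c d (\<lambda>x. x))"
  proof (rule smooth_on_cong)
    fix w assume w: "w \<in> ?L \<inter> V"
    then have "s w \<in> S" "?\<phi> (s w) = w" using L V(4,5) by blast+
    then obtain x where x: "s w = chart_map a x" "x \<in> chart_dom a" "?p x \<in> chart_dom c"
      using Selem by blast
    have "w = chart_map c (?p x)"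
      using \<open>?\<phi> (s w) = w\<close> x by (simp add: local_rep_apply[OF inja])
    then show "local_rep a d ?p (s w) = local_rep c d (\<lambda>x. x) w"
      using x by (simp add: local_rep_apply[OF inja] local_rep_apply[OF injc])
  qed
  then show "\<exists>W. open W \<and> z \<in> W \<and> smooth_on (?L \<inter> W) (local_rep c d (\<lambda>x. x))"
    using V(1,2) zu by auto
qed

section \<open>Conjugate subgroups and the translation of cosets\<close>

lemma conj_subgroup_subgroup:
  assumes "group G" "subgroup H G" "a \<in> carrier G"
  shows "subgroup (conj_subgroup G a H) G"
proof -
  interpret group G by fact
  interpret H: subgroup H G by fact
  have "(\<lambda>h. a \<otimes>\<^bsub>G\<^esub> h \<otimes>\<^bsub>G\<^esub> inv\<^bsub>G\<^esub> a) \<in> hom G G"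
    using assms(3) by (auto simp: hom_def m_assoc mult_inv_cancel_left)
  then interpret group_hom G G "\<lambda>h. a \<otimes>\<^bsub>G\<^esub> h \<otimes>\<^bsub>G\<^esub> inv\<^bsub>G\<^esub> a"
    by unfold_locales
  show ?thesis unfolding conj_subgroup_def using subgroup_img_is_subgroup[OF assms(2)] .
qed

text \<open>Makes the situation symmetric: each fact about the translation from \<open>G/H\<close>
  also serves in the reverse direction, with the inverse of \<open>a\<close> and the conjugate
  subgroup in place of \<open>a\<close> and \<open>H\<close>.\<close>

lemma conj_subgroup_inv:
  assumes "group G" "subgroup H G" "a \<in> carrier G"
  shows "conj_subgroup G (inv\<^bsub>G\<^esub> a) (conj_subgroup G a H) = H"
proof -
  interpret group G by fact
  interpret H: subgroup H G by fact
  have "inv\<^bsub>G\<^esub> a \<otimes>\<^bsub>G\<^esub> (a \<otimes>\<^bsub>G\<^esub> h \<otimes>\<^bsub>G\<^esub> inv\<^bsub>G\<^esub> a) \<otimes>\<^bsub>G\<^esub> inv\<^bsub>G\<^esub> (inv\<^bsub>G\<^esub> a) = h" if "h \<in> H" for h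
    using that assms(3) by (simp add: m_assoc mult_inv_cancel_left)
  then show ?thesis unfolding conj_subgroup_def by (force simp: image_image)
qed

lemma coset_proj_conj:
  assumes "group G" "subgroup H G" "a \<in> carrier G" "x \<in> carrier G"
  shows "(\<lambda>y. y \<otimes>\<^bsub>G\<^esub> inv\<^bsub>G\<^esub> a) ` coset_proj G H x
    = coset_proj G (conj_subgroup G a H) (x \<otimes>\<^bsub>G\<^esub> inv\<^bsub>G\<^esub> a)"
proof -
  interpret group G by fact
  interpret H: subgroup H G by fact
  have "x \<otimes>\<^bsub>G\<^esub> inv\<^bsub>G\<^esub> a \<otimes>\<^bsub>G\<^esub> (a \<otimes>\<^bsub>G\<^esub> h \<otimes>\<^bsub>G\<^esub> inv\<^bsub>G\<^esub> a) = x \<otimes>\<^bsub>G\<^esub> h \<otimes>\<^bsub>G\<^esub> inv\<^bsub>G\<^esub> a" if "h \<in> H" for h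
  proof -
    have "inv\<^bsub>G\<^esub> a \<otimes>\<^bsub>G\<^esub> (a \<otimes>\<^bsub>G\<^esub> (h \<otimes>\<^bsub>G\<^esub> inv\<^bsub>G\<^esub> a)) = h \<otimes>\<^bsub>G\<^esub> inv\<^bsub>G\<^esub> a"
      using that assms(3) by (simp add: mult_inv_cancel_left)
    then show ?thesis using that assms(3,4) by (simp add: m_assoc)
  qed
  then show ?thesis unfolding coset_proj_def l_coset_def conj_subgroup_def by (force simp: image_image)
qed

lemma coset_translation_inverse:
  assumes "group G" "subgroup H G" "a \<in> carrier G" "C \<in> lcosets\<^bsub>G\<^esub> H"
  shows "(\<lambda>y. y \<otimes>\<^bsub>G\<^esub> inv\<^bsub>G\<^esub> (inv\<^bsub>G\<^esub> a)) ` (\<lambda>y. y \<otimes>\<^bsub>G\<^esub> inv\<^bsub>G\<^esub> a) ` C = C"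
proof -
  interpret group G by fact
  have "C \<subseteq> carrier G" using lcosets_part_G[OF assms(2)] assms(4) by blast
  then have "y \<otimes>\<^bsub>G\<^esub> inv\<^bsub>G\<^esub> a \<otimes>\<^bsub>G\<^esub> inv\<^bsub>G\<^esub> (inv\<^bsub>G\<^esub> a) = y" if "y \<in> C" for y
    using that assms(3) by (auto simp: m_assoc)
  then show ?thesis by (force simp: image_image)
qed

lemma coset_translation_lcosets:
  assumes "group G" "subgroup H G" "a \<in> carrier G" "C \<in> lcosets\<^bsub>G\<^esub> H"
  shows "(\<lambda>y. y \<otimes>\<^bsub>G\<^esub> inv\<^bsub>G\<^esub> a) ` C \<in> lcosets\<^bsub>G\<^esub> (conj_subgroup G a H)"
proof -
  interpret group G by fact
  obtain x where "x \<in> carrier G" "C = coset_proj G H x" using lcosets_obtain[OF assms(4)] .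
  then show ?thesis
    using coset_proj_conj[OF assms(1-3)] assms(3) unfolding lcosets_coset_proj by auto
qed

lemma coset_translation_continuous:
  assumes lie: "lie_group G M" and H: "subgroup H G" and a: "a \<in> carrier G"
  shows "continuous_map (coset_topology G H (mfd_top M))
    (coset_topology G (conj_subgroup G a H) (mfd_top M)) ((`) (\<lambda>y. y \<otimes>\<^bsub>G\<^esub> inv\<^bsub>G\<^esub> a))"
proof -
  have G: "group G" and pts: "points M = carrier G" using lie unfolding lie_group_def by auto
  interpret group G by fact
  let ?K = "conj_subgroup G a H"
  let ?\<Phi> = "(`) (\<lambda>y. y \<otimes>\<^bsub>G\<^esub> inv\<^bsub>G\<^esub> a)"
  have K: "subgroup ?K G" by (rule conj_subgroup_subgroup[OF G H a])
  have R: "continuous_map (mfd_top M) (mfd_top M) (\<lambda>y. y \<otimes>\<^bsub>G\<^esub> inv\<^bsub>G\<^esub> a)"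
    using lie_group_right_translation_smooth[OF lie, of "inv\<^bsub>G\<^esub> a"] a unfolding smooth_map_def by simp
  have "openin (coset_topology G H (mfd_top M)) {C \<in> lcosets\<^bsub>G\<^esub> H. ?\<Phi> C \<in> U}" (is "openin _ ?V")
    if "openin (coset_topology G ?K (mfd_top M)) U" for U
  proof -
    have U: "U \<subseteq> lcosets\<^bsub>G\<^esub> ?K" "openin (mfd_top M) (\<Union>U)"
      using that unfolding openin_coset_topology[OF G K] by auto
    have "\<Union>?V = {x \<in> carrier G. coset_proj G H x \<in> ?V}" by (rule Union_cosets[OF G H]) blast
    also have "\<dots> = {x \<in> carrier G. x \<otimes>\<^bsub>G\<^esub> inv\<^bsub>G\<^esub> a \<in> \<Union>U}"
      unfolding Union_cosets[OF G K U(1)]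
      using coset_proj_conj[OF G H a] a by (auto simp: lcosets_coset_proj)
    finally show ?thesis
      unfolding openin_coset_topology[OF G H]
      using openin_continuous_map_preimage[OF R U(2)] pts by auto
  qed
  then show ?thesis
    unfolding continuous_map_def topspace_coset_topology[OF G H pts] topspace_coset_topology[OF G K pts]
    using coset_translation_lcosets[OF G H a] by auto
qed

lemma coset_translation_homeomorphic:
  assumes lie: "lie_group G M" and H: "subgroup H G" and a: "a \<in> carrier G"
  shows "homeomorphic_maps (coset_topology G H (mfd_top M))
    (coset_topology G (conj_subgroup G a H) (mfd_top M))
    ((`) (\<lambda>y. y \<otimes>\<^bsub>G\<^esub> inv\<^bsub>G\<^esub> a)) ((`) (\<lambda>y. y \<otimes>\<^bsub>G\<^esub> inv\<^bsub>G\<^esub> (inv\<^bsub>G\<^esub> a)))"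
proof -
  have G: "group G" and pts: "points M = carrier G" using lie unfolding lie_group_def by auto
  have ia: "inv\<^bsub>G\<^esub> a \<in> carrier G" using group.inv_closed[OF G a] .
  have K: "subgroup (conj_subgroup G a H) G" by (rule conj_subgroup_subgroup[OF G H a])
  note top = topspace_coset_topology[OF G H pts] topspace_coset_topology[OF G K pts]
  show ?thesis
    unfolding homeomorphic_maps_def top
    using coset_translation_continuous[OF lie H a] coset_translation_continuous[OF lie K ia]
      coset_translation_inverse[OF G H a] coset_translation_inverse[OF G K ia]
      conj_subgroup_inv[OF G H a] group.inv_inv[OF G a]
    by auto
qed

text \<open>The explicit set \<open>S\<close> keeps the domain inside the source space, as
  \<open>f\<close> is defined on the whole type.\<close>

definition pullback_chart :: "'a set \<Rightarrow> ('a \<Rightarrow> 'b) \<Rightarrow> ('b, 'e) chart \<Rightarrow> ('a, 'e) chart" where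
  "pullback_chart S f d = \<lparr>chart_dom = {x \<in> S. f x \<in> chart_dom d}, chart_map = chart_map d \<circ> f,
     chart_space = chart_space d\<rparr>"

lemma pullback_chart_simps [simp]:
  "chart_dom (pullback_chart S f d) = {x \<in> S. f x \<in> chart_dom d}"
  "chart_map (pullback_chart S f d) = chart_map d \<circ> f"
  "chart_space (pullback_chart S f d) = chart_space d"
  by (simp_all add: pullback_chart_def)

lemma is_chart_pullback:
  assumes hom: "homeomorphic_map X Y f" and d: "is_chart Y d"
  shows "is_chart X (pullback_chart (topspace X) f d)"
proof -
  let ?S = "{x \<in> topspace X. f x \<in> chart_dom d}"
  have im: "f ` ?S = chart_dom d"
    using homeomorphic_imp_surjective_map[OF hom] is_chartD(4)[OF d] by auto
  have "openin X ?S"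
    by (rule openin_continuous_map_preimage[OF homeomorphic_imp_continuous_map[OF hom] is_chartD(1)[OF d]])
  moreover have "homeomorphic_map (subtopology X ?S) (subtopology Y (chart_dom d)) f"
    by (rule homeomorphic_map_subtopologies[OF hom])
      (use im is_chartD(4)[OF d] in auto)
  then have "homeomorphic_map (subtopology X ?S) (top_of_set (chart_map d ` chart_dom d)) (chart_map d \<circ> f)"
    by (rule homeomorphic_map_compose) (use d in \<open>simp add: is_chart_def\<close>)
  moreover have "(chart_map d \<circ> f) ` ?S = chart_map d ` chart_dom d"
    unfolding image_comp[symmetric] im ..
  ultimately show ?thesis
    using d by (simp add: is_chart_def)
qed

text \<open>Translating a coset of \<open>H\<close> is projecting the translated element modulo the
  conjugate subgroup. So the projection onto \<open>G/H\<close>, read in the pulled-back chart, is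
  the other projection after a right translation of \<open>G\<close>, read in
  \<open>d\<close>.\<close>

lemma homogeneous_space_pullback_chart:
  fixes M :: "('g, 'e::euclidean_space) mfd"
  assumes lie: "lie_group G M" and H: "subgroup H G" and a: "a \<in> carrier G"
    and d: "d \<in> mfd_atlas (homogeneous_space G (conj_subgroup G a H) M)"
  shows "pullback_chart (lcosets\<^bsub>G\<^esub> H) ((`) (\<lambda>y. y \<otimes>\<^bsub>G\<^esub> inv\<^bsub>G\<^esub> a)) d
    \<in> mfd_atlas (homogeneous_space G H M)" (is "?d \<in> _")
proof -
  have G: "group G" and pts: "points M = carrier G" and M: "smooth_manifold M"
    using lie unfolding lie_group_def by auto
  interpret group G by fact
  let ?K = "conj_subgroup G a H"
  let ?\<Phi> = "(`) (\<lambda>y. y \<otimes>\<^bsub>G\<^esub> inv\<^bsub>G\<^esub> a)"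
  let ?R = "\<lambda>y. y \<otimes>\<^bsub>G\<^esub> inv\<^bsub>G\<^esub> a"
  have K: "subgroup ?K G" by (rule conj_subgroup_subgroup[OF G H a])
  have chd: "is_chart (coset_topology G ?K (mfd_top M)) d"
    and sub: "\<And>c. c \<in> mfd_atlas M \<Longrightarrow> submersive_in_charts c d (coset_proj G ?K)"
    using d unfolding homogeneous_space_simps by auto
  have "homeomorphic_map (coset_topology G H (mfd_top M)) (coset_topology G ?K (mfd_top M)) ?\<Phi>"
    using coset_translation_homeomorphic[OF lie H a] unfolding homeomorphic_maps_map by (rule conjunct1)
  then have "is_chart (coset_topology G H (mfd_top M)) ?d"
    unfolding topspace_coset_topology[OF G H pts, symmetric] by (rule is_chart_pullback[OF _ chd])
  moreover have "submersive_in_charts c ?d (coset_proj G H)" if c: "c \<in> mfd_atlas M" for c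
  proof -
    have s: "submersive_in_charts c d (\<lambda>x. coset_proj G ?K (?R x))"
    proof (rule submersive_in_charts_diffeomorphism[OF M, where R' = "\<lambda>y. y \<otimes>\<^bsub>G\<^esub> a"])
      show "smooth_map M M ?R" "smooth_map M M (\<lambda>y. y \<otimes>\<^bsub>G\<^esub> a)"
        using lie_group_right_translation_smooth[OF lie] a by auto
      show "continuous_map (mfd_top M) (coset_topology G ?K (mfd_top M)) (coset_proj G ?K)"
        by (rule coset_proj_continuous[OF G K pts])
    qed (use a pts is_chartD(1)[OF chd] sub c in \<open>auto simp: m_assoc\<close>)
    note chc = smooth_manifoldD(1)[OF M c]
    have inM: "x \<in> carrier G" if "x \<in> chart_dom c" for x
      using is_chartD(4)[OF chc] pts that by blast
    have eq: "?\<Phi> (coset_proj G H x) = coset_proj G ?K (?R x)" "coset_proj G H x \<in> lcosets\<^bsub>G\<^esub> H"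
      if "x \<in> chart_dom c" for x
      using coset_proj_conj[OF G H a inM[OF that]] inM[OF that] by (auto simp: lcosets_coset_proj)
    have L: "local_dom c ?d (coset_proj G H) = local_dom c d (\<lambda>x. coset_proj G ?K (?R x))"
      unfolding local_dom_def using eq by auto
    have rep: "local_rep c d (\<lambda>x. coset_proj G ?K (?R x)) u = local_rep c ?d (coset_proj G H) u"
      if "u \<in> local_dom c d (\<lambda>x. coset_proj G ?K (?R x))" for u
      using that eq unfolding local_dom_def by (auto simp: local_rep_apply[OF is_chartD(3)[OF chc]])
    show ?thesis
      unfolding submersive_in_charts_def smooth_in_charts_def L
    proof (intro conjI ballI)
      show "smooth_on (local_dom c d (\<lambda>x. coset_proj G ?K (?R x))) (local_rep c ?d (coset_proj G H))"
        by (rule smooth_on_cong[OF _ rep])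
          (use s in \<open>simp add: submersive_in_charts_def smooth_in_charts_def\<close>)
      fix u assume u: "u \<in> local_dom c d (\<lambda>x. coset_proj G ?K (?R x))"
      then obtain D where D: "(local_rep c d (\<lambda>x. coset_proj G ?K (?R x)) has_derivative D)
            (at u within local_dom c d (\<lambda>x. coset_proj G ?K (?R x)))" "D ` chart_space c = chart_space d"
        using s unfolding submersive_in_charts_def by blast
      have "(local_rep c ?d (coset_proj G H) has_derivative D)
          (at u within local_dom c d (\<lambda>x. coset_proj G ?K (?R x)))"
        by (rule has_derivative_transform[OF u _ D(1)]) (simp only: rep)
      then show "\<exists>D. (local_rep c ?d (coset_proj G H) has_derivative D)
            (at u within local_dom c d (\<lambda>x. coset_proj G ?K (?R x))) \<and>
          D ` chart_space c = chart_space ?d"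
        using D(2) by auto
    qed
  qed
  ultimately show ?thesis unfolding homogeneous_space_simps by blast
qed

lemma coset_translation_smooth:
  fixes M :: "('g, 'e::euclidean_space) mfd"
  assumes lie: "lie_group G M" and H: "subgroup H G" and a: "a \<in> carrier G"
  shows "smooth_map (homogeneous_space G H M) (homogeneous_space G (conj_subgroup G a H) M)
    ((`) (\<lambda>y. y \<otimes>\<^bsub>G\<^esub> inv\<^bsub>G\<^esub> a))"
  unfolding smooth_map_def homogeneous_space_simps(1)
proof (intro conjI ballI coset_translation_continuous[OF assms])
  have G: "group G" and pts: "points M = carrier G" and M: "smooth_manifold M"
    using lie unfolding lie_group_def by auto
  let ?\<Phi> = "(`) (\<lambda>y. y \<otimes>\<^bsub>G\<^esub> inv\<^bsub>G\<^esub> a)"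
  fix c d assume c: "c \<in> mfd_atlas (homogeneous_space G H M)"
    and d: "d \<in> mfd_atlas (homogeneous_space G (conj_subgroup G a H) M)"
  let ?d = "pullback_chart (lcosets\<^bsub>G\<^esub> H) ?\<Phi> d"
  have "chart_dom c \<subseteq> lcosets\<^bsub>G\<^esub> H"
    using c is_chartD(4) topspace_coset_topology[OF G H pts] unfolding homogeneous_space_simps by blast
  \<comment> \<open>The chart map of \<open>?d\<close> is \<open>chart_map d\<close> after the
    translation, so the identity read in \<open>c\<close> and \<open>?d\<close> is literally the
    translation read in \<open>c\<close> and \<open>d\<close>.\<close>
  then have "local_dom c ?d (\<lambda>x. x) = local_dom c d ?\<Phi>" by (auto simp: local_dom_def)
  moreover have "local_rep c ?d (\<lambda>x. x) = local_rep c d ?\<Phi>" by (auto simp: local_rep_def)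
  ultimately show "smooth_in_charts c d ?\<Phi>"
    using homogeneous_space_charts_compatible[OF G H M pts c homogeneous_space_pullback_chart[OF assms d]]
    by (simp add: smooth_in_charts_def)
qed

lemma coset_translation_diffeomorphism:
  fixes M :: "('g, 'e::euclidean_space) mfd"
  assumes lie: "lie_group G M" and H: "subgroup H G" and a: "a \<in> carrier G"
  shows "diffeomorphism (homogeneous_space G H M) (homogeneous_space G (conj_subgroup G a H) M)
    ((`) (\<lambda>y. y \<otimes>\<^bsub>G\<^esub> inv\<^bsub>G\<^esub> a))"
  unfolding diffeomorphism_def
proof (intro conjI coset_translation_smooth[OF assms])
  have G: "group G" using lie unfolding lie_group_def by auto
  let ?K = "conj_subgroup G a H"
  let ?Q = "homogeneous_space G H M" and ?QK = "homogeneous_space G ?K M"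
  let ?\<Phi> = "(`) (\<lambda>y. y \<otimes>\<^bsub>G\<^esub> inv\<^bsub>G\<^esub> a)" and ?\<Psi> = "(`) (\<lambda>y. y \<otimes>\<^bsub>G\<^esub> inv\<^bsub>G\<^esub> (inv\<^bsub>G\<^esub> a))"
  have ia: "inv\<^bsub>G\<^esub> a \<in> carrier G" using group.inv_closed[OF G a] .
  have K: "subgroup ?K G" by (rule conj_subgroup_subgroup[OF G H a])
  have hom: "homeomorphic_maps (mfd_top ?Q) (mfd_top ?QK) ?\<Phi> ?\<Psi>"
    unfolding homogeneous_space_simps by (rule coset_translation_homeomorphic[OF assms])
  then have inv: "\<forall>x\<in>points ?Q. ?\<Psi> (?\<Phi> x) = x" "\<forall>y\<in>points ?QK. ?\<Phi> (?\<Psi> y) = y"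
    and maps: "?\<Phi> ` points ?Q \<subseteq> points ?QK" "?\<Psi> ` points ?QK \<subseteq> points ?Q"
    unfolding homeomorphic_maps_def continuous_map_def by auto
  show bij: "bij_betw ?\<Phi> (points ?Q) (points ?QK)"
    by (rule bij_betw_byWitness[OF inv maps])
  have "smooth_map ?QK ?Q ?\<Psi>"
    using coset_translation_smooth[OF lie K ia] conj_subgroup_inv[OF G H a] by simp
  then show "smooth_map ?QK ?Q (inv_into (points ?Q) ?\<Phi>)"
  proof (rule smooth_map_cong[rotated 2])
    show "?\<Psi> y = inv_into (points ?Q) ?\<Phi> y" if "y \<in> points ?QK" for y
    proof (rule inv_into_f_eq[symmetric])
      show "inj_on ?\<Phi> (points ?Q)" using bij by (rule bij_betw_imp_inj_on)
    qed (use maps inv that in auto)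
  qed (auto simp: homogeneous_space_simps)
qed

text \<open>The charts are transported along the translation: composing smooth maps would require that they
  cover the homogeneous space, which is the closed subgroup theorem.\<close>

lemma smooth_funs_coset_translation:
  fixes M :: "('g, 'e::euclidean_space) mfd"
  assumes lie: "lie_group G M" and H: "subgroup H G" and a: "a \<in> carrier G"
    and f: "f \<in> smooth_funs (homogeneous_space G (conj_subgroup G a H) M)"
  shows "f \<circ> (`) (\<lambda>y. y \<otimes>\<^bsub>G\<^esub> inv\<^bsub>G\<^esub> a) \<in> smooth_funs (homogeneous_space G H M)"
proof -
  have G: "group G" and pts: "points M = carrier G" using lie unfolding lie_group_def by auto
  let ?K = "conj_subgroup G a H"
  let ?Q = "homogeneous_space G H M" and ?QK = "homogeneous_space G ?K M"
  let ?\<Phi> = "(`) (\<lambda>y. y \<otimes>\<^bsub>G\<^esub> inv\<^bsub>G\<^esub> a)" and ?\<Psi> = "(`) (\<lambda>y. y \<otimes>\<^bsub>G\<^esub> inv\<^bsub>G\<^esub> (inv\<^bsub>G\<^esub> a))"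
  have ia: "inv\<^bsub>G\<^esub> a \<in> carrier G" using group.inv_closed[OF G a] .
  have K: "subgroup ?K G" by (rule conj_subgroup_subgroup[OF G H a])
  have f': "smooth_map ?QK (euclidean_mfd :: (real, real) mfd) f" using f unfolding smooth_funs_def by simp
  have "continuous_map (mfd_top ?Q) (mfd_top (euclidean_mfd :: (real, real) mfd)) (f \<circ> ?\<Phi>)"
    using coset_translation_smooth[OF lie H a] f' continuous_map_compose unfolding smooth_map_def by blast
  moreover have "smooth_in_charts c e (f \<circ> ?\<Phi>)"
    if c: "c \<in> mfd_atlas ?Q" and e: "e \<in> mfd_atlas (euclidean_mfd :: (real, real) mfd)" for c e
  proof -
    let ?c = "pullback_chart (lcosets\<^bsub>G\<^esub> ?K) ?\<Psi> c"
    have c': "?c \<in> mfd_atlas ?QK"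
      by (rule homogeneous_space_pullback_chart[OF lie K ia]) (use c conj_subgroup_inv[OF G H a] in simp)
    have injc': "inj_on (chart_map ?c) (chart_dom ?c)"
      using c' is_chartD(3) unfolding homogeneous_space_simps by blast
    have chc: "is_chart (coset_topology G H (mfd_top M)) c"
      using c unfolding homogeneous_space_simps by blast
    have c_sub: "B \<in> lcosets\<^bsub>G\<^esub> H" if "B \<in> chart_dom c" for B
      using that is_chartD(4)[OF chc] topspace_coset_topology[OF G H pts] by blast
    have elem: "?\<Phi> B \<in> chart_dom ?c \<and> chart_map ?c (?\<Phi> B) = chart_map c B" if "B \<in> chart_dom c" for B
      using that coset_translation_inverse[OF G H a c_sub[OF that]]
        coset_translation_lcosets[OF G H a c_sub[OF that]] by simp
    have s: "smooth_on (local_dom ?c e f) (local_rep ?c e f)"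
      using f' c' e unfolding smooth_map_def smooth_in_charts_def by blast
    show ?thesis
      unfolding smooth_in_charts_def
    proof (rule smooth_on_cong[OF smooth_on_subset[OF s]])
      show "local_dom c e (f \<circ> ?\<Phi>) \<subseteq> local_dom ?c e f"
      proof
        fix u assume "u \<in> local_dom c e (f \<circ> ?\<Phi>)"
        then obtain B where B: "u = chart_map c B" "B \<in> chart_dom c" "f (?\<Phi> B) \<in> chart_dom e"
          unfolding local_dom_def by auto
        have "u = chart_map ?c (?\<Phi> B)" "?\<Phi> B \<in> {x \<in> chart_dom ?c. f x \<in> chart_dom e}"
          using elem[OF B(2)] B by (metis, blast)
        then show "u \<in> local_dom ?c e f" unfolding local_dom_def by (rule image_eqI)
      qed
      fix u assume "u \<in> local_dom c e (f \<circ> ?\<Phi>)"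
      then obtain B where B: "u = chart_map c B" "B \<in> chart_dom c"
        unfolding local_dom_def by auto
      have "local_rep ?c e f u = chart_map e (f (?\<Phi> B))"
        using local_rep_apply[OF injc', of "?\<Phi> B" e f] elem[OF B(2)] B(1) by metis
      also have "\<dots> = local_rep c e (f \<circ> ?\<Phi>) u"
        unfolding B(1) local_rep_apply[OF is_chartD(3)[OF chc] B(2)] by simp
      finally show "local_rep ?c e f u = local_rep c e (f \<circ> ?\<Phi>) u" .
    qed
  qed
  ultimately show ?thesis unfolding smooth_funs_def smooth_map_def by blast
qed

section \<open>Invariance of the Poisson tensor\<close>

lemma const_smooth_funs:
  assumes "smooth_manifold M"
  shows "(\<lambda>x. k) \<in> smooth_funs M"
proof -
  have "smooth_in_charts c e (\<lambda>x. k)" for c :: "('a, 'b) chart" and e :: "(real, real) chart"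
    unfolding smooth_in_charts_def
  proof (rule smooth_on_cong[OF smooth_on_subset[OF smooth_on_Ck[OF open_UNIV]]])
    show "Ck_on j UNIV (\<lambda>x. chart_map e k)" for j by (rule Ck_on_const[OF open_UNIV])
  qed (auto simp: local_rep_def)
  then show ?thesis
    by (simp add: smooth_funs_def smooth_map_def euclidean_mfd_def)
qed

text \<open>Smooth functions have arbitrary values outside the manifold; the difference of \<open>f\<close> and \<open>g\<close>
  equals its own product with a smooth function vanishing on the manifold, so the Leibniz rule
  annihilates it.\<close>

lemma tangent_space_cong:
  assumes M: "smooth_manifold M" and x: "x \<in> points M" and D: "D \<in> tangent_space M x"
    and fg: "\<And>y. y \<in> points M \<Longrightarrow> f y = g y"
  shows "D f = D g"
proof -
  have sm: "f \<in> smooth_funs M \<longleftrightarrow> g \<in> smooth_funs M" by (rule smooth_funs_cong[OF M fg])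
  show ?thesis
  proof (cases "f \<in> smooth_funs M")
    case False
    then show ?thesis using D sm unfolding tangent_space_def by auto
  next
    case f: True
    then have g: "g \<in> smooth_funs M" using sm by blast
    define n where "n = (\<lambda>y. 1 * f y + (-1) * g y)"
    define h where "h = (\<lambda>y. if y \<in> points M then 0 else 1 :: real)"
    have n: "n \<in> smooth_funs M" and h: "h \<in> smooth_funs M"
      using smooth_funs_cong[OF M, of n "\<lambda>x. 0"] smooth_funs_cong[OF M, of h "\<lambda>x. 0"]
        const_smooth_funs[OF M, of 0] fg
      by (auto simp: n_def h_def)
    have "D n = 1 * D f + (-1) * D g"
      using D f g unfolding n_def tangent_space_def by blast
    moreover have "D (\<lambda>y. n y * h y) = n x * D h + h x * D n"
      using D n h unfolding tangent_space_def by blast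
    moreover have "(\<lambda>y. n y * h y) = n" using fg by (auto simp: n_def h_def)
    moreover have "n x = 0" "h x = 0" using x fg by (auto simp: n_def h_def)
    ultimately show ?thesis by simp
  qed
qed

text \<open>A bivector is a derivation in its first argument by definition; skew-symmetry brings the
  second argument into that slot, so \<open>tangent_space_cong\<close> settles both.\<close>

lemma bivectors_cong:
  assumes M: "smooth_manifold M" "x \<in> points M" and B: "B \<in> bivectors M x"
    and "\<And>y. y \<in> points M \<Longrightarrow> f y = f' y" "\<And>y. y \<in> points M \<Longrightarrow> g y = g' y"
  shows "B f g = B f' g'"
proof -
  have skew: "B u v = - B v u" and tan: "(\<lambda>u. B u v) \<in> tangent_space M x" for u v
    using B unfolding bivectors_def by blast+
  have "B f g = B f' g" by (rule tangent_space_cong[OF M tan assms(4)])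
  also have "\<dots> = - B g f'" by (rule skew)
  also have "\<dots> = - B g' f'" using tangent_space_cong[OF M tan assms(5)] by simp
  also have "\<dots> = B f' g'" by (rule skew[symmetric])
  finally show ?thesis .
qed

lemma bivectors_not_smooth:
  assumes "B \<in> bivectors M x" "f \<notin> smooth_funs M \<or> g \<notin> smooth_funs M"
  shows "B f g = 0"
proof -
  have "B f g = - B g f" and zero: "u \<notin> smooth_funs M \<Longrightarrow> B u v = 0" for u v
    using assms(1) unfolding bivectors_def tangent_space_def by blast+
  then show ?thesis using assms(2) zero[of f g] zero[of g f] by auto
qed

lemma velocity_constant:
  assumes "\<And>t. f (\<gamma> t) = k"
  shows "velocity M \<gamma> f = 0"
proof -
  have "f \<circ> \<gamma> = (\<lambda>t. k)" using assms by auto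
  then show ?thesis by (simp add: velocity_def)
qed

text \<open>Each term of \<open>wedge (X i) (Y i)\<close> contains \<open>X i\<close> applied to one
  of the two translated functions, and \<open>X i\<close> is the velocity of a curve in
  \<open>K\<close>, along which both are constant.\<close>

lemma left_transl_wedge_span_invariant:
  assumes "W \<in> wedge_span (subgroup_lie_algebra G M K) T"
    and "\<And>k'. k' \<in> K \<Longrightarrow> f (k \<otimes>\<^bsub>G\<^esub> k') = u" "\<And>k'. k' \<in> K \<Longrightarrow> g (k \<otimes>\<^bsub>G\<^esub> k') = v"
  shows "left_transl G M k W f g = 0"
proof -
  obtain n :: nat and a X Y where W: "W = (\<lambda>f g. \<Sum>i<n. a i * wedge (X i) (Y i) f g)"
      "\<forall>i<n. X i \<in> subgroup_lie_algebra G M K"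
    using assms(1) unfolding wedge_span_def by blast
  have "X i (f \<circ> (\<lambda>x. k \<otimes>\<^bsub>G\<^esub> x)) = 0 \<and> X i (g \<circ> (\<lambda>x. k \<otimes>\<^bsub>G\<^esub> x)) = 0" if i: "i < n" for i
  proof -
    obtain \<gamma> where "X i = velocity M \<gamma>" "\<And>t. \<gamma> t \<in> K"
      using W(2) i unfolding subgroup_lie_algebra_def by blast
    then show ?thesis
      using velocity_constant[of "f \<circ> (\<lambda>x. k \<otimes>\<^bsub>G\<^esub> x)" \<gamma> u M]
        velocity_constant[of "g \<circ> (\<lambda>x. k \<otimes>\<^bsub>G\<^esub> x)" \<gamma> v M] assms(2,3)
      by simp
  qed
  then show ?thesis
    by (auto simp: left_transl_def pushforward_def W(1) wedge_def intro!: sum.neutral)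
qed

lemma coisotropic_subgroup_invariant:
  fixes M :: "('g, 'e::euclidean_space) mfd"
  assumes pl: "poisson_lie_group G M \<pi>" and co: "coisotropic_subgroup G M \<pi> K"
    and x: "x \<in> carrier G" and k: "k \<in> K"
    and f: "\<And>y k. y \<in> carrier G \<Longrightarrow> k \<in> K \<Longrightarrow> f (y \<otimes>\<^bsub>G\<^esub> k) = f y"
    and g: "\<And>y k. y \<in> carrier G \<Longrightarrow> k \<in> K \<Longrightarrow> g (y \<otimes>\<^bsub>G\<^esub> k) = g y"
  shows "\<pi> (x \<otimes>\<^bsub>G\<^esub> k) f g = \<pi> x f g"
proof -
  have G: "group G" and M: "smooth_manifold M" and pts: "points M = carrier G"
    and biv: "\<And>y. y \<in> carrier G \<Longrightarrow> \<pi> y \<in> bivectors M y" and mult: "multiplicative G M \<pi>"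
    using pl unfolding poisson_lie_group_def lie_group_def poisson_structure_def by auto
  interpret group G by fact
  interpret K: subgroup K G
    using co unfolding coisotropic_subgroup_def closed_subgroup_def by blast
  have kG: "k \<in> carrier G" using k by simp
  show ?thesis
  \<comment> \<open>If one of the functions is not smooth, both sides are 0 by the convention on
    derivations; otherwise \<open>right_transl\<close> unfolds without its default value.\<close>
  proof (cases "f \<in> smooth_funs M \<and> g \<in> smooth_funs M")
    case False
    then show ?thesis
      using bivectors_not_smooth[OF biv[OF x]] bivectors_not_smooth[OF biv[OF m_closed[OF x kG]]] by auto
  next
    case True
    obtain W where W: "\<pi> k = left_transl G M k W"
        "W \<in> wedge_span (subgroup_lie_algebra G M K) (tangent_space M \<one>\<^bsub>G\<^esub>)"
      using co k unfolding coisotropic_subgroup_def by blast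
    have inv: "h (x \<otimes>\<^bsub>G\<^esub> (k \<otimes>\<^bsub>G\<^esub> k')) = h x"
      if "k' \<in> K" "\<And>y k. y \<in> carrier G \<Longrightarrow> k \<in> K \<Longrightarrow> h (y \<otimes>\<^bsub>G\<^esub> k) = h y" for k' and h :: "'g \<Rightarrow> real"
      using that x k by simp
    \<comment> \<open>After left translation by \<open>x\<close>, the two functions are constant on
      the coset of \<open>k\<close> modulo \<open>K\<close>, with values \<open>f x\<close> and
      \<open>g x\<close>.\<close>
    have "\<pi> k (f \<circ> (\<lambda>y. x \<otimes>\<^bsub>G\<^esub> y)) (g \<circ> (\<lambda>y. x \<otimes>\<^bsub>G\<^esub> y)) = 0"
      unfolding W(1) using inv f g
      by (intro left_transl_wedge_span_invariant[OF W(2), where u = "f x" and v = "g x"]) auto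
    then have "left_transl G M x (\<pi> k) f g = 0"
      by (simp add: left_transl_def pushforward_def)
    moreover have "right_transl G M k (\<pi> x) f g = \<pi> x (f \<circ> (\<lambda>y. y \<otimes>\<^bsub>G\<^esub> k)) (g \<circ> (\<lambda>y. y \<otimes>\<^bsub>G\<^esub> k))"
      using True by (simp add: right_transl_def pushforward_def)
    \<comment> \<open>The invariance of \<open>f\<close> and \<open>g\<close> is known on the
      carrier only, so the composites need not be equal as functions on the type.\<close>
    moreover have "\<pi> x (f \<circ> (\<lambda>y. y \<otimes>\<^bsub>G\<^esub> k)) (g \<circ> (\<lambda>y. y \<otimes>\<^bsub>G\<^esub> k)) = \<pi> x f g"
      by (rule bivectors_cong[OF M _ biv[OF x]]) (use x k f g pts in auto)
    moreover have "\<pi> (x \<otimes>\<^bsub>G\<^esub> k) f g = left_transl G M x (\<pi> k) f g + right_transl G M k (\<pi> x) f g"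
      using mult x kG unfolding multiplicative_def by simp
    ultimately show ?thesis by simp
  qed
qed

text \<open>Projectability gives all preimages of \<open>F x\<close> the same pushforward, so any
  one of them computes the definite description.\<close>

lemma project_field_eq:
  assumes "projectable M N F \<rho>" "x \<in> points M"
  shows "project_field M N F \<rho> (F x) = pushforward M N F (\<rho> x)"
  unfolding project_field_def
proof (rule the_equality)
  show "\<forall>x'\<in>points M. F x' = F x \<longrightarrow> pushforward M N F (\<rho> x') = pushforward M N F (\<rho> x)"
    using assms unfolding projectable_def by blast
  show "B = pushforward M N F (\<rho> x)"
    if "\<forall>x'\<in>points M. F x' = F x \<longrightarrow> pushforward M N F (\<rho> x') = B" for B
    using that assms(2) by blast
qed

theorem proposition4:
  fixes G :: "'g monoid"
    and M :: "('g, 'e::euclidean_space) mfd"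
    and \<pi> :: "'g \<Rightarrow> 'g tensor2"
    and H :: "'g set"
    and \<sigma> :: 'g
  defines "H\<sigma> \<equiv> conj_subgroup G \<sigma> H"
    and "\<pi>\<sigma> \<equiv> affine_translate G M \<sigma> \<pi>"
    and "p \<equiv> coset_proj G H"
    and "p\<sigma> \<equiv> coset_proj G (conj_subgroup G \<sigma> H)"
    and "Q \<equiv> homogeneous_space G H M"
    and "Q\<sigma> \<equiv> homogeneous_space G (conj_subgroup G \<sigma> H) M"
  assumes "poisson_lie_group G M \<pi>"
    and "closed_subgroup H G M"
    and "\<sigma> \<in> carrier G"
    and "coisotropic_subgroup G M \<pi> H\<sigma>"
  shows "projectable M Q p \<pi>\<sigma> \<and> projectable M Q\<sigma> p\<sigma> \<pi> \<and>
         poisson_diffeomorphic Q (project_field M Q p \<pi>\<sigma>) Q\<sigma> (project_field M Q\<sigma> p\<sigma> \<pi>)"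
proof -
  note pl = assms(7) and \<sigma> = assms(9) and co = assms(10)
  have lie: "lie_group G M" and G: "group G" and M: "smooth_manifold M" and pts: "points M = carrier G"
    and biv: "\<And>y. y \<in> carrier G \<Longrightarrow> \<pi> y \<in> bivectors M y"
    using pl unfolding poisson_lie_group_def lie_group_def poisson_structure_def by auto
  interpret group G by fact
  have H: "subgroup H G" using assms(8) unfolding closed_subgroup_def by blast
  interpret H: subgroup H G by fact
  have K: "subgroup H\<sigma> G" unfolding H\<sigma>_def by (rule conj_subgroup_subgroup[OF G H \<sigma>])
  have p\<sigma>_eq: "p\<sigma> = coset_proj G H\<sigma>" unfolding p\<sigma>_def H\<sigma>_def ..
  define \<Phi> where "\<Phi> = (`) (\<lambda>y. y \<otimes>\<^bsub>G\<^esub> inv\<^bsub>G\<^esub> \<sigma>)"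
  have \<Phi>p: "\<Phi> (p x) = p\<sigma> (x \<otimes>\<^bsub>G\<^esub> inv\<^bsub>G\<^esub> \<sigma>)" if "x \<in> carrier G" for x
    unfolding \<Phi>_def p_def p\<sigma>_def by (rule coset_proj_conj[OF G H \<sigma> that])
  \<comment> \<open>From \<open>k = \<sigma> h \<sigma>^-1\<close> follows
    \<open>k \<sigma> = \<sigma> h\<close>: composing with right translation by
    \<open>\<sigma>\<close> turns right \<open>H\<close>-invariant functions into right
    \<open>H\<sigma>\<close>-invariant ones.\<close>
  have conj: "\<exists>h\<in>H. y \<otimes>\<^bsub>G\<^esub> k \<otimes>\<^bsub>G\<^esub> \<sigma> = y \<otimes>\<^bsub>G\<^esub> \<sigma> \<otimes>\<^bsub>G\<^esub> h" if "y \<in> carrier G" "k \<in> H\<sigma>" for y k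
  proof -
    obtain h where h: "h \<in> H" "k = \<sigma> \<otimes>\<^bsub>G\<^esub> h \<otimes>\<^bsub>G\<^esub> inv\<^bsub>G\<^esub> \<sigma>"
      using \<open>k \<in> H\<sigma>\<close> unfolding H\<sigma>_def conj_subgroup_def by blast
    then have "y \<otimes>\<^bsub>G\<^esub> k \<otimes>\<^bsub>G\<^esub> \<sigma> = y \<otimes>\<^bsub>G\<^esub> \<sigma> \<otimes>\<^bsub>G\<^esub> h" using that(1) \<sigma> by (simp add: m_assoc)
    then show ?thesis using h(1) by blast
  qed
  have proj\<sigma>: "projectable M Q\<sigma> p\<sigma> \<pi>"
    unfolding projectable_def pts
  proof (intro ballI impI)
    fix x x' assume x: "x \<in> carrier G" "x' \<in> carrier G" "p\<sigma> x = p\<sigma> x'"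
    then obtain k where k: "k \<in> H\<sigma>" "x' = x \<otimes>\<^bsub>G\<^esub> k"
      using coset_proj_eqD[OF G K x(2)] unfolding p\<sigma>_eq by blast
    have "\<pi> x' (f \<circ> p\<sigma>) (g \<circ> p\<sigma>) = \<pi> x (f \<circ> p\<sigma>) (g \<circ> p\<sigma>)" for f g
      unfolding k(2)
      by (rule coisotropic_subgroup_invariant[OF pl co x(1) k(1)])
        (simp_all add: p\<sigma>_eq coset_proj_mult[OF G K])
    then show "pushforward M Q\<sigma> p\<sigma> (\<pi> x) = pushforward M Q\<sigma> p\<sigma> (\<pi> x')"
      by (auto simp: pushforward_def fun_eq_iff)
  qed
  have proj: "projectable M Q p \<pi>\<sigma>"
    unfolding projectable_def pts
  proof (intro ballI impI)
    fix x x' assume x: "x \<in> carrier G" "x' \<in> carrier G" "p x = p x'"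
    then obtain h where h: "h \<in> H" "x' = x \<otimes>\<^bsub>G\<^esub> h"
      using coset_proj_eqD[OF G H x(2)] unfolding p_def by blast
    \<comment> \<open>\<open>\<pi>\<sigma>\<close> reads \<open>\<pi>\<close> at points translated
      by the inverse of \<open>\<sigma>\<close>; the translates of \<open>x\<close> and
      \<open>x'\<close> differ by the conjugate \<open>?k\<close> of \<open>h\<close>, where
      coisotropy of \<open>H\<sigma>\<close> applies.\<close>
    let ?k = "\<sigma> \<otimes>\<^bsub>G\<^esub> h \<otimes>\<^bsub>G\<^esub> inv\<^bsub>G\<^esub> \<sigma>"
    have k: "?k \<in> H\<sigma>" using h(1) unfolding H\<sigma>_def conj_subgroup_def by blast
    have x\<sigma>: "x \<otimes>\<^bsub>G\<^esub> inv\<^bsub>G\<^esub> \<sigma> \<in> carrier G" using x(1) \<sigma> by simp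
    have x': "x' \<otimes>\<^bsub>G\<^esub> inv\<^bsub>G\<^esub> \<sigma> = x \<otimes>\<^bsub>G\<^esub> inv\<^bsub>G\<^esub> \<sigma> \<otimes>\<^bsub>G\<^esub> ?k"
      using x(1) \<sigma> h by (simp add: m_assoc mult_inv_cancel_left)
    have inv: "((f \<circ> p) \<circ> (\<lambda>y. y \<otimes>\<^bsub>G\<^esub> \<sigma>)) (y \<otimes>\<^bsub>G\<^esub> k) = ((f \<circ> p) \<circ> (\<lambda>y. y \<otimes>\<^bsub>G\<^esub> \<sigma>)) y"
      if y: "y \<in> carrier G" "k \<in> H\<sigma>" for f :: "'g set \<Rightarrow> real" and y k
    proof -
      obtain h where "h \<in> H" "y \<otimes>\<^bsub>G\<^esub> k \<otimes>\<^bsub>G\<^esub> \<sigma> = y \<otimes>\<^bsub>G\<^esub> \<sigma> \<otimes>\<^bsub>G\<^esub> h" using conj[OF y] by blast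
      then show ?thesis using coset_proj_mult[OF G H, of "y \<otimes>\<^bsub>G\<^esub> \<sigma>" h] y(1) \<sigma> by (simp add: p_def)
    qed
    have "\<pi> (x' \<otimes>\<^bsub>G\<^esub> inv\<^bsub>G\<^esub> \<sigma>) ((f \<circ> p) \<circ> (\<lambda>y. y \<otimes>\<^bsub>G\<^esub> \<sigma>)) ((g \<circ> p) \<circ> (\<lambda>y. y \<otimes>\<^bsub>G\<^esub> \<sigma>))
        = \<pi> (x \<otimes>\<^bsub>G\<^esub> inv\<^bsub>G\<^esub> \<sigma>) ((f \<circ> p) \<circ> (\<lambda>y. y \<otimes>\<^bsub>G\<^esub> \<sigma>)) ((g \<circ> p) \<circ> (\<lambda>y. y \<otimes>\<^bsub>G\<^esub> \<sigma>))" for f g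
      unfolding x' by (rule coisotropic_subgroup_invariant[OF pl co x\<sigma> k inv inv])
    then have "\<pi>\<sigma> x' (f \<circ> p) (g \<circ> p) = \<pi>\<sigma> x (f \<circ> p) (g \<circ> p)" for f g
      unfolding \<pi>\<sigma>_def affine_translate_def right_transl_def pushforward_def by metis
    then show "pushforward M Q p (\<pi>\<sigma> x) = pushforward M Q p (\<pi>\<sigma> x')"
      by (auto simp: pushforward_def fun_eq_iff)
  qed
  have "pushforward Q Q\<sigma> \<Phi> (project_field M Q p \<pi>\<sigma> X) = project_field M Q\<sigma> p\<sigma> \<pi> (\<Phi> X)"
    if X: "X \<in> points Q" for X
  proof -
    have "X \<in> lcosets\<^bsub>G\<^esub> H"
      using X topspace_coset_topology[OF G H pts] unfolding Q_def homogeneous_space_simps by simp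
    then obtain x where x: "x \<in> carrier G" "X = p x" unfolding p_def by (rule lcosets_obtain)
    let ?y = "x \<otimes>\<^bsub>G\<^esub> inv\<^bsub>G\<^esub> \<sigma>"
    have y: "?y \<in> carrier G" using x(1) \<sigma> by simp
    have lhs: "project_field M Q p \<pi>\<sigma> X = pushforward M Q p (\<pi>\<sigma> x)"
      unfolding x(2) by (rule project_field_eq[OF proj]) (simp add: pts x)
    have rhs: "project_field M Q\<sigma> p\<sigma> \<pi> (\<Phi> X) = pushforward M Q\<sigma> p\<sigma> (\<pi> ?y)"
      unfolding x(2) \<Phi>p[OF x(1)] by (rule project_field_eq[OF proj\<sigma>]) (simp add: pts y)
    \<comment> \<open>Used in contrapositive form: when the left side of the identity below is the
      default 0 of \<open>right_transl\<close>, one of \<open>f \<circ> p\<sigma>\<close> and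
      \<open>g \<circ> p\<sigma>\<close> is not smooth either, so the bivector on the right side
      vanishes too.\<close>
    have smooth: "(f \<circ> \<Phi>) \<circ> p \<in> smooth_funs M" if f: "f \<circ> p\<sigma> \<in> smooth_funs M" for f
    proof -
      have "smooth_map M (euclidean_mfd :: (real, real) mfd) (\<lambda>z. (f \<circ> p\<sigma>) (z \<otimes>\<^bsub>G\<^esub> inv\<^bsub>G\<^esub> \<sigma>))"
        by (rule smooth_map_compose[OF smooth_manifoldD(1)[OF M] M, where g = "f \<circ> p\<sigma>"])
          (use lie_group_right_translation_smooth[OF lie] f \<sigma> in \<open>auto simp: smooth_funs_def\<close>)
      then show ?thesis
        using smooth_funs_cong[OF M, of "(f \<circ> \<Phi>) \<circ> p" "\<lambda>z. (f \<circ> p\<sigma>) (z \<otimes>\<^bsub>G\<^esub> inv\<^bsub>G\<^esub> \<sigma>)"] \<Phi>p pts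
        by (simp add: smooth_funs_def)
    qed
    have "\<pi>\<sigma> x ((f \<circ> \<Phi>) \<circ> p) ((g \<circ> \<Phi>) \<circ> p) = \<pi> ?y (f \<circ> p\<sigma>) (g \<circ> p\<sigma>)" for f g
    proof (cases "(f \<circ> \<Phi>) \<circ> p \<in> smooth_funs M \<and> (g \<circ> \<Phi>) \<circ> p \<in> smooth_funs M")
      case True
      have "((f \<circ> \<Phi>) \<circ> p) (z \<otimes>\<^bsub>G\<^esub> \<sigma>) = (f \<circ> p\<sigma>) z" if "z \<in> carrier G" for f :: "'g set \<Rightarrow> real" and z
        using that \<sigma> \<Phi>p[of "z \<otimes>\<^bsub>G\<^esub> \<sigma>"] by (simp add: m_assoc)
      then have "\<pi> ?y (((f \<circ> \<Phi>) \<circ> p) \<circ> (\<lambda>z. z \<otimes>\<^bsub>G\<^esub> \<sigma>)) (((g \<circ> \<Phi>) \<circ> p) \<circ> (\<lambda>z. z \<otimes>\<^bsub>G\<^esub> \<sigma>))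
          = \<pi> ?y (f \<circ> p\<sigma>) (g \<circ> p\<sigma>)"
        by (intro bivectors_cong[OF M _ biv[OF y]]) (use y pts in auto)
      then show ?thesis
        using True by (simp add: \<pi>\<sigma>_def affine_translate_def right_transl_def pushforward_def)
    next
      case False
      then have "\<pi>\<sigma> x ((f \<circ> \<Phi>) \<circ> p) ((g \<circ> \<Phi>) \<circ> p) = 0"
        by (auto simp: \<pi>\<sigma>_def affine_translate_def right_transl_def pushforward_def)
      then show ?thesis using bivectors_not_smooth[OF biv[OF y]] smooth False by metis
    qed
    \<comment> \<open>Two pushforwards are nested on the left; this keeps the inner one, along
      \<open>p\<close>, from returning its default 0 when the outer one does not.\<close>
    moreover have "f \<circ> \<Phi> \<in> smooth_funs Q" if "f \<in> smooth_funs Q\<sigma>" for f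
      using smooth_funs_coset_translation[OF lie H \<sigma>] that unfolding Q_def Q\<sigma>_def \<Phi>_def .
    ultimately show ?thesis unfolding lhs rhs by (auto simp: pushforward_def fun_eq_iff)
  qed
  moreover have "diffeomorphism Q Q\<sigma> \<Phi>"
    unfolding Q_def Q\<sigma>_def \<Phi>_def by (rule coset_translation_diffeomorphism[OF lie H \<sigma>])
  ultimately show ?thesis using proj proj\<sigma> unfolding poisson_diffeomorphic_def by blast
qed

end
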